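(* Let $(u_n(x))_{n\ge0}$ be a simple and non-degenerate binary recurrence sequence of complex polynomials, $$u_{n+2}(x)=A_1(x)u_{n+1}(x)+A_0(x)u_n(x)\quad(n\ge0),$$ with $u_0,u_1,A_0,A_1\in\mathbb{C}[x]$, so that $u_n(x)=\sigma_1\alpha_1^n+\sigma_2\alpha_2^n$ for all $n\ge 0$ in the notation of the context. There exists a positive real constant $C=C(\{A_i,u_i:i=0,1\})$, depending only on $A_0,A_1,u_0,u_1$, with the following property. Suppose that for some $n_1\le n_2$ we have $$u_{n_1}(x)+u_{n_2}(x)=g(h(x))$$ with $g,h\in\mathbb{C}[x]$, where $h$ is indecomposable and neither cyclic nor dihedral. Let $y\neq x$ be a root of $h(T)-h(x)$, let $\beta_i,\delta_i$ $(i=1,2)$ be as in the context, and suppose that the equation $$\sigma_1\alpha_1^{n_1}+\sigma_2\alpha_2^{n_1}+\sigma_1\alpha_1^{n_2}+\sigma_2\alpha_2^{n_2}=\delta_1\beta_1^{n_1}+\delta_2\beta_2^{n_1}+\delta_1\beta_1^{n_2}+\delta_2\beta_2^{n_2}$$ has no proper vanishing subsum. Then $\deg g\le C$.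
   Context: All algebraic functions are taken in a fixed algebraic closure of $\mathbb{C}(x)$. $\alpha_1,\alpha_2$ are the roots of the characteristic polynomial $T^2-A_1(x)T-A_0(x)$: $$\alpha_1=\frac{A_1-\sqrt{A_1^2+4A_0}}{2},\qquad \alpha_2=\frac{A_1+\sqrt{A_1^2+4A_0}}{2}.$$ The sequence is simple if $\alpha_1\ne\alpha_2$ (i.e. $A_1^2+4A_0\neq0$), and non-degenerate if $\alpha_1/\alpha_2$ is not constant (not in $\mathbb{C}$). Then $u_n(x)=\sigma_1\alpha_1^n+\sigma_2\alpha_2^n$ for all $n\ge0$, where $$\sigma_1=\frac{u_1-u_0\alpha_2}{\alpha_1-\alpha_2},\qquad \sigma_2=\frac{u_0\alpha_1-u_1}{\alpha_1-\alpha_2}.$$ For $h$ indecomposable (so $\deg h\ge2$), the polynomial $h(T)-h(x)\in\mathbb{C}(h(x))[T]$ is irreducible, and there is a root $y\ne x$ of it; thus $h(x)=h(y)$. Conjugating over $\mathbb{C}(h(x))$ via $x\mapsto y$, one gets $u_n(y)=\delta_1\beta_1^n+\delta_2\beta_2^n$ for all $n\ge 0$, where $\beta_1,\beta_2$ are the distinct roots of $T^2-A_1(y)T-A_0(y)$ in its splitting field $L_2$ over $\mathbb{C}(y)$ and $\delta_1,\delta_2\in L_2$. If $u_{n_1}+u_{n_2}=g\circ h$, then $u_{n_1}(x)+u_{n_2}(x)=u_{n_1}(y)+u_{n_2}(y)$, which is the second displayed equation in the claim. "No proper vanishing subsum" means: after moving all eight terms to one side, no nonempty proper subset of the eight terms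 (with signs) sums to zero. A complex polynomial of degree at least $2$ is indecomposable if it is not a composition of two complex polynomials both of degree at least $2$. A polynomial $h\in\mathbb{C}[x]$ is cyclic if $h=\ell_1\circ x^k\circ\ell_2$ for some $k\ge2$ and linear $\ell_1,\ell_2\in\mathbb{C}[x]$; it is dihedral if $h=\ell_1\circ T_k\circ\ell_2$ for some $k\ge3$ and linear $\ell_1,\ell_2\in\mathbb{C}[x]$, where $T_k$ is the $k$-th Chebyshev polynomial of the first kind ($T_0=1$, $T_1=x$, $T_{k+2}=2xT_{k+1}-T_k$). *)

theory Defs
  imports
    "HOL-Computational_Algebra.Computational_Algebra"
    "HOL-Algebra.Algebraic_Closure_Type"
    "HOL-Algebra.Generated_Fields"
begin

text \<open>The fixed algebraic closure of \<open>\<complex>(x)\<close>.\<close>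
type_synonym algfun = "complex poly fract alg_closure"

definition af_const :: "complex \<Rightarrow> algfun" where
  "af_const c = to_ac (to_fract [:c:])"

definition af_x :: algfun where
  "af_x = to_ac (to_fract [:0, 1:])"

text \<open>The value \<open>p(z)\<close> at an algebraic function; in particular
  \<open>af_eval p af_x\<close> is \<open>p\<close> itself, viewed as an algebraic function.\<close>
definition af_eval :: "complex poly \<Rightarrow> algfun \<Rightarrow> algfun" where
  "af_eval p z = poly (map_poly af_const p) z"

text \<open>An arbitrary but fixed square root of each element; the other choice of the sign
  merely interchanges \<open>\<alpha>\<^sub>1, \<sigma>\<^sub>1\<close> with \<open>\<alpha>\<^sub>2, \<sigma>\<^sub>2\<close> below.\<close>
definition af_sqrt :: "algfun \<Rightarrow> algfun" where
  "af_sqrt a = (SOME s. s ^ 2 = a)"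

lemma af_sqrt_power2: "af_sqrt a ^ 2 = a"
  unfolding af_sqrt_def by (rule someI_ex) (rule nth_root_exists, simp)

definition binary_recurrence :: "complex poly \<Rightarrow> complex poly \<Rightarrow> (nat \<Rightarrow> complex poly) \<Rightarrow> bool" where
  "binary_recurrence A0 A1 u \<longleftrightarrow> (\<forall>n. u (n + 2) = A1 * u (n + 1) + A0 * u n)"

text \<open>The characteristic polynomial \<open>T\<^sup>2 - A\<^sub>1(z) T - A\<^sub>0(z)\<close>.\<close>
definition char_poly_at :: "complex poly \<Rightarrow> complex poly \<Rightarrow> algfun \<Rightarrow> algfun poly" where
  "char_poly_at A0 A1 z = [:- af_eval A0 z, - af_eval A1 z, 1:]"

definition alpha1 :: "complex poly \<Rightarrow> complex poly \<Rightarrow> algfun" where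
  "alpha1 A0 A1 = (af_eval A1 af_x - af_sqrt (af_eval (A1 ^ 2 + 4 * A0) af_x)) / 2"

definition alpha2 :: "complex poly \<Rightarrow> complex poly \<Rightarrow> algfun" where
  "alpha2 A0 A1 = (af_eval A1 af_x + af_sqrt (af_eval (A1 ^ 2 + 4 * A0) af_x)) / 2"

definition simple_rec :: "complex poly \<Rightarrow> complex poly \<Rightarrow> bool" where
  "simple_rec A0 A1 \<longleftrightarrow> alpha1 A0 A1 \<noteq> alpha2 A0 A1"

text \<open>If \<open>\<alpha>\<^sub>2 = 0\<close>, then \<open>\<alpha>\<^sub>1 / \<alpha>\<^sub>2 = 0\<close> by the convention for division by zero, so the
  recurrence counts as degenerate, exactly as in the case \<open>\<alpha>\<^sub>1 = 0\<close>.\<close>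
definition nondegenerate_rec :: "complex poly \<Rightarrow> complex poly \<Rightarrow> bool" where
  "nondegenerate_rec A0 A1 \<longleftrightarrow> alpha1 A0 A1 / alpha2 A0 A1 \<notin> range af_const"

definition sigma1 :: "complex poly \<Rightarrow> complex poly \<Rightarrow> (nat \<Rightarrow> complex poly) \<Rightarrow> algfun" where
  "sigma1 A0 A1 u =
     (af_eval (u 1) af_x - af_eval (u 0) af_x * alpha2 A0 A1) / (alpha1 A0 A1 - alpha2 A0 A1)"

definition sigma2 :: "complex poly \<Rightarrow> complex poly \<Rightarrow> (nat \<Rightarrow> complex poly) \<Rightarrow> algfun" where
  "sigma2 A0 A1 u =
     (af_eval (u 0) af_x * alpha1 A0 A1 - af_eval (u 1) af_x) / (alpha1 A0 A1 - alpha2 A0 A1)"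

text \<open>The data \<open>\<beta>\<^sub>i, \<delta>\<^sub>i\<close> at \<open>y\<close>: the splitting field of the characteristic polynomial over
  \<open>\<complex>(y)\<close> is the subfield generated by \<open>\<complex>\<close>, \<open>y\<close> and the two roots.\<close>
definition rec_splitting_field :: "algfun \<Rightarrow> algfun \<Rightarrow> algfun \<Rightarrow> algfun set" where
  "rec_splitting_field y \<beta>1 \<beta>2 =
     generate_field ring_of_type_algebra (range af_const \<union> {y, \<beta>1, \<beta>2})"

definition conjugate_data ::
    "complex poly \<Rightarrow> complex poly \<Rightarrow> (nat \<Rightarrow> complex poly) \<Rightarrow> algfun \<Rightarrow>
     algfun \<Rightarrow> algfun \<Rightarrow> algfun \<Rightarrow> algfun \<Rightarrow> bool" where
  "conjugate_data A0 A1 u y \<beta>1 \<beta>2 \<delta>1 \<delta>2 \<longleftrightarrow>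
     \<beta>1 \<noteq> \<beta>2 \<and>
     poly (char_poly_at A0 A1 y) \<beta>1 = 0 \<and> poly (char_poly_at A0 A1 y) \<beta>2 = 0 \<and>
     \<delta>1 \<in> rec_splitting_field y \<beta>1 \<beta>2 \<and> \<delta>2 \<in> rec_splitting_field y \<beta>1 \<beta>2 \<and>
     (\<forall>n. af_eval (u n) y = \<delta>1 * \<beta>1 ^ n + \<delta>2 * \<beta>2 ^ n)"

text \<open>The list holds the signed terms after moving everything to one side. Subsums are indexed
  by positions, so equal terms at different positions are kept apart.\<close>
definition no_proper_vanishing_subsum :: "algfun list \<Rightarrow> bool" where
  "no_proper_vanishing_subsum ts \<longleftrightarrow>
     (\<forall>I. I \<noteq> {} \<and> I \<subset> {..<length ts} \<longrightarrow> (\<Sum>i\<in>I. ts ! i) \<noteq> 0)"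

definition indecomposable :: "complex poly \<Rightarrow> bool" where
  "indecomposable h \<longleftrightarrow> degree h \<ge> 2 \<and>
     \<not> (\<exists>f g. degree f \<ge> 2 \<and> degree g \<ge> 2 \<and> h = pcompose f g)"

definition cyclic_poly :: "complex poly \<Rightarrow> bool" where
  "cyclic_poly h \<longleftrightarrow> (\<exists>k l1 l2. k \<ge> 2 \<and> degree l1 = 1 \<and> degree l2 = 1 \<and>
     h = pcompose l1 (pcompose ([:0, 1:] ^ k) l2))"

fun chebyshev :: "nat \<Rightarrow> complex poly" where
  "chebyshev 0 = 1"
| "chebyshev (Suc 0) = [:0, 1:]"
| "chebyshev (Suc (Suc k)) = 2 * [:0, 1:] * chebyshev (Suc k) - chebyshev k"

definition dihedral_poly :: "complex poly \<Rightarrow> bool" where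
  "dihedral_poly h \<longleftrightarrow> (\<exists>k l1 l2. k \<ge> 3 \<and> degree l1 = 1 \<and> degree l2 = 1 \<and>
     h = pcompose l1 (pcompose (chebyshev k) l2))"

end

theory Submission
  imports Defs
begin

text \<open>Write \<open>m\<close> for the degree of \<open>h\<close>. Comparing degrees in
  \<open>u\<^sub>n\<^sub>1 + u\<^sub>n\<^sub>2 = g \<circ> h\<close> gives \<open>m deg g \<le> \<kappa> (n\<^sub>2 + 1)\<close> with \<open>\<kappa>\<close> depending
  on the recurrence only, so it suffices to bound \<open>n\<^sub>2\<close> by a constant times \<open>m\<close>. This is a
  question of heights: the ratio \<open>\<theta> = \<sigma>\<^sub>1 \<alpha>\<^sub>1\<^sup>n / (\<sigma>\<^sub>2 \<alpha>\<^sub>2\<^sup>n)\<close>, \<open>n = n\<^sub>2\<close>, has height of order \<open>n\<close>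
  because \<open>\<alpha>\<^sub>1 / \<alpha>\<^sub>2\<close> is not constant, while the vanishing eight-term sum forces its height to
  be of order \<open>m\<close>.

  The upper bound comes from differentiation. Each of the eight terms has a logarithmic
  derivative that is a quotient of polynomials in \<open>x\<close>, \<open>y\<close>, \<open>s = \<alpha>\<^sub>1 - \<alpha>\<^sub>2\<close> and
  \<open>r = \<beta>\<^sub>1 - \<beta>\<^sub>2\<close> of weight \<open>O(m)\<close>, uniformly in the exponents; the factor \<open>m\<close> enters through
  \<open>y' = h'(x) / h'(y)\<close>. Dividing a relation by one of its terms and differentiating
  shortens it at the cost of a bounded factor in the weight, and since no proper subsum
  vanishes, every quotient of two of the terms turns out to be a quotient of two such
  polynomials of weight \<open>O(m)\<close> (\<open>relation_splits_along_classes\<close>, \<open>ratio_in_filtration\<close>).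

  For the lower bound, \<open>\<theta> + 1/\<theta> + 2\<close> is symmetric in the two roots and hence a
  rational function, namely \<open>u\<^sub>n\<^sup>2 \<Delta> / (E (- A\<^sub>0)\<^sup>n)\<close> with \<open>\<Delta> = A\<^sub>1\<^sup>2 + 4 A\<^sub>0\<close> and
  \<open>E = u\<^sub>0 u\<^sub>1 A\<^sub>1 - u\<^sub>1\<^sup>2 + u\<^sub>0\<^sup>2 A\<^sub>0\<close>. At a place of \<open>\<complex>(x)\<close> where
  \<open>2 v(A\<^sub>1) < v(A\<^sub>0)\<close> it has a pole of order at least \<open>n - c\<close>
  (\<open>ex_separating_valuation\<close>, \<open>v_recurrence_bound\<close>).

  The two bounds are compared by counting dimensions instead of summing over the places
  of the field \<open>\<complex>(x, y, s, r)\<close>. If \<open>d\<close> is the degree of \<open>y\<close> over \<open>\<complex>(x)\<close>, then the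
  polynomials of weight at most \<open>k\<close> span a space of dimension at most \<open>4 d (k + 1)\<close>
  (\<open>weight_space_bound\<close>). A rational function \<open>A / B\<close> with \<open>A\<close>, \<open>B\<close> of weight \<open>M\<close> and with a
  pole or zero of order \<open>N\<close> yields the \<open>d N (q + 1)\<close> independent elements
  \<open>y\<^sup>j \<pi>\<^sup>l A\<^sup>i B\<^sup>q\<^sup>-\<^sup>i\<close> of weight \<open>q M + O(1)\<close>; letting \<open>q\<close> grow gives \<open>N \<le> 4 M\<close>
  (\<open>valuation_bound\<close>), in which the unknown \<open>d\<close> has cancelled.\<close>

section \<open>Extending a derivation to an algebraic extension\<close>

text \<open>Dual numbers \<open>a + b \<epsilon>\<close> with \<open>\<epsilon>\<^sup>2 = 0\<close>. A map \<open>D\<close> is a derivation iff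
  \<open>a \<mapsto> a + D(a) \<epsilon>\<close> is a ring homomorphism, so partial derivations can be handled as
  subrings of the dual numbers and need no domain of their own.\<close>
datatype 'a dual = Dual (re: 'a) (eps: 'a)

instantiation dual :: (comm_ring_1) comm_ring_1
begin

definition zero_dual :: "'a dual" where "0 = Dual 0 0"
definition one_dual :: "'a dual" where "1 = Dual 1 0"
definition plus_dual :: "'a dual \<Rightarrow> 'a dual \<Rightarrow> 'a dual"
  where "a + b = Dual (re a + re b) (eps a + eps b)"
definition uminus_dual :: "'a dual \<Rightarrow> 'a dual" where "- a = Dual (- re a) (- eps a)"
definition minus_dual :: "'a dual \<Rightarrow> 'a dual \<Rightarrow> 'a dual"
  where "a - b = Dual (re a - re b) (eps a - eps b)"
definition times_dual :: "'a dual \<Rightarrow> 'a dual \<Rightarrow> 'a dual"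
  where "a * b = Dual (re a * re b) (re a * eps b + eps a * re b)"

instance
  by standard (auto simp: zero_dual_def one_dual_def plus_dual_def uminus_dual_def
      minus_dual_def times_dual_def algebra_simps)

end

lemma dual_sel [simp]:
  "re (0 :: 'a dual) = 0" "eps (0 :: 'a dual) = 0"
  "re (1 :: 'a dual) = 1" "eps (1 :: 'a dual) = 0"
  "re (a + b) = re a + re b" "eps (a + b) = eps a + eps b"
  "re (- a) = - re a" "eps (- a) = - eps a"
  "re (a - b) = re a - re b" "eps (a - b) = eps a - eps b"
  "re (a * b) = re a * re b" "eps (a * b) = re a * eps b + eps a * re b"
  for a b :: "'a :: comm_ring_1 dual"
  by (simp_all add: zero_dual_def one_dual_def plus_dual_def uminus_dual_def
      minus_dual_def times_dual_def)

lemma re_poly: "re (poly P z) = poly (map_poly re P) (re z)" for z :: "'a :: comm_ring_1 dual"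
  by (induction P) (simp_all add: map_poly_pCons)

lemma eps_poly:
  "eps (poly P (Dual z w)) = poly (map_poly eps P) z + poly (pderiv (map_poly re P)) z * w"
  for z w :: "'a :: idom"
  by (induction P) (simp_all add: map_poly_pCons re_poly pderiv_pCons algebra_simps)

text \<open>The graph of a derivation on a subring. The last condition says that the relation is
  single-valued: it applies to the difference of two elements over the same point.\<close>
definition deriv_graph :: "'a :: field dual set \<Rightarrow> bool" where
  "deriv_graph G \<longleftrightarrow> 1 \<in> G \<and> (\<forall>a\<in>G. \<forall>b\<in>G. a - b \<in> G \<and> a * b \<in> G) \<and>
     (\<forall>a\<in>G. re a = 0 \<longrightarrow> a = 0)"

lemma deriv_graphD:
  assumes "deriv_graph G"
  shows "0 \<in> G" "1 \<in> G" "a \<in> G \<Longrightarrow> b \<in> G \<Longrightarrow> a - b \<in> G" "a \<in> G \<Longrightarrow> b \<in> G \<Longrightarrow> a * b \<in> G"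
    "a \<in> G \<Longrightarrow> re a = 0 \<Longrightarrow> a = 0" "a \<in> G \<Longrightarrow> - a \<in> G" "a \<in> G \<Longrightarrow> b \<in> G \<Longrightarrow> a + b \<in> G"
proof -
  show 0: "0 \<in> G" using assms unfolding deriv_graph_def by (metis diff_self)
  show d: "a \<in> G \<Longrightarrow> b \<in> G \<Longrightarrow> a - b \<in> G" for a b using assms unfolding deriv_graph_def by blast
  show u: "a \<in> G \<Longrightarrow> - a \<in> G" for a using d[OF 0] by (metis diff_0)
  show "a \<in> G \<Longrightarrow> b \<in> G \<Longrightarrow> a + b \<in> G" using d[OF _ u] by (metis diff_minus_eq_add)
qed (use assms in \<open>auto simp: deriv_graph_def\<close>)

text \<open>The quotient rule: a derivation extends to the fractions of its domain. Only elements
  with nonzero first component are invertible among the dual numbers, which is why the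
  denominators are restricted in this way.\<close>
lemma deriv_graph_fractions:
  assumes G: "deriv_graph (G :: 'a :: field dual set)"
  defines "G' \<equiv> {c. \<exists>b\<in>G. re b \<noteq> 0 \<and> c * b \<in> G}"
  shows "deriv_graph G'" "G \<subseteq> G'"
proof -
  note D = deriv_graphD[OF G]
  show "G \<subseteq> G'" unfolding G'_def using D(2) by (auto intro!: bexI[of _ 1])
  show "deriv_graph G'"
    unfolding deriv_graph_def
  proof (intro conjI ballI impI)
    show "1 \<in> G'" using D(2) by (auto simp: G'_def intro!: bexI[of _ 1])
  next
    fix c d assume "c \<in> G'" "d \<in> G'"
    then obtain a b where ab: "a \<in> G" "re a \<noteq> 0" "c * a \<in> G" "b \<in> G" "re b \<noteq> 0" "d * b \<in> G"
      unfolding G'_def by blast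
    have ab': "a * b \<in> G" "re (a * b) \<noteq> 0" using ab D(4) by auto
    have "(c - d) * (a * b) = (c * a) * b - (d * b) * a" "(c * d) * (a * b) = (c * a) * (d * b)"
      by (simp_all add: algebra_simps)
    hence "(c - d) * (a * b) \<in> G" "(c * d) * (a * b) \<in> G"
      using ab D(3,4) by metis+
    thus "c - d \<in> G'" "c * d \<in> G'" unfolding G'_def using ab' by blast+
  next
    fix c assume c: "c \<in> G'" "re c = 0"
    then obtain b where b: "b \<in> G" "re b \<noteq> 0" "c * b \<in> G" by (auto simp: G'_def)
    have "c * b = 0" using D(5)[OF b(3)] c by simp
    hence "eps c * re b = 0" using c(2) by (metis dual_sel(2,12) add_0 mult_zero_left)
    thus "c = 0" using b(2) c(2) by (simp add: dual.expand)
  qed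
qed

lemma maximal_deriv_graph_inverse:
  assumes G: "deriv_graph (G :: 'a :: field dual set)"
    and max: "\<And>G'. deriv_graph G' \<Longrightarrow> G \<subseteq> G' \<Longrightarrow> G' = G"
    and b: "b \<in> G" "re b \<noteq> 0"
  shows "\<exists>c\<in>G. c * b = 1"
proof -
  define c where "c = Dual (1 / re b) (- eps b / (re b)^2)"
  have cb: "c * b = 1"
    using b(2) by (intro dual.expand) (simp add: c_def field_simps power2_eq_square)
  have "c \<in> {c. \<exists>b\<in>G. re b \<noteq> 0 \<and> c * b \<in> G}"
    using b cb deriv_graphD(2)[OF G] by auto
  hence "c \<in> G" using max[OF deriv_graph_fractions[OF G]] by simp
  thus ?thesis using cb by blast
qed

text \<open>If \<open>p(z) = 0\<close> with \<open>p\<close> of minimal degree, then \<open>z\<close> can only be given the derivative \<open>w\<close>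
  for which the dual number \<open>\<zeta> = z + w \<epsilon>\<close> is a root of the lifted polynomial. The ring
  generated by \<open>\<zeta>\<close> is again single-valued because every polynomial that vanishes at \<open>z\<close> is a
  multiple of \<open>p\<close> and therefore vanishes at \<open>\<zeta>\<close>.\<close>
lemma maximal_deriv_graph_total:
  fixes G :: "'a :: field dual set"
  assumes char: "CHAR('a) = 0" and G: "deriv_graph G"
    and max: "\<And>G'. deriv_graph G' \<Longrightarrow> G \<subseteq> G' \<Longrightarrow> G' = G"
    and alg: "\<exists>P. (\<forall>i. coeff P i \<in> G) \<and> P \<noteq> 0 \<and> poly (map_poly re P) z = 0"
  shows "\<exists>w. Dual z w \<in> G"
proof -
  note D = deriv_graphD[OF G]
  note cl = D(1-4,6,7)
  define A where "A = (\<lambda>P. (\<forall>i. coeff P i \<in> G) \<and> P \<noteq> 0 \<and> poly (map_poly re P) z = 0)"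
  have map0: "map_poly re P \<noteq> 0" "degree (map_poly re P) = degree P"
    if "\<forall>i. coeff P i \<in> G" "P \<noteq> 0" for P
  proof -
    have "re (lead_coeff P) \<noteq> 0" using that D(5) by (metis leading_coeff_0_iff)
    thus "map_poly re P \<noteq> 0" "degree (map_poly re P) = degree P"
      by (metis coeff_map_poly coeff_0 dual_sel(1), intro map_poly_degree_eq)
  qed
  define d where "d = (LEAST d. \<exists>P. A P \<and> degree P = d)"
  have ex: "\<exists>d P. A P \<and> degree P = d" using alg unfolding A_def by blast
  obtain p where p: "A p" "degree p = d"
    using LeastI_ex[OF ex] unfolding d_def by blast
  have min: "d \<le> degree q" if "A q" for q
    unfolding d_def using that by (intro Least_le) blast
  have pG: "\<forall>i. coeff p i \<in> G" "p \<noteq> 0" "poly (map_poly re p) z = 0" using p by (auto simp: A_def)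
  have d0: "d > 0"
  proof (rule ccontr)
    assume "\<not> d > 0"
    hence "degree (map_poly re p) = 0" using p(2) map0[OF pG(1,2)] by simp
    then obtain c where "map_poly re p = [:c:]" by (meson degree_eq_zeroE)
    thus False using pG(3) map0[OF pG(1,2)] by simp
  qed
  define p' where "p' = poly (pderiv (map_poly re p)) z"
  have ofnat: "of_nat n \<in> G" for n by (induction n) (auto intro: cl)
  have p': "p' \<noteq> 0"
  proof
    assume z: "p' = 0"
    define dp where "dp = (\<Sum>i<d. monom (of_nat (Suc i) * coeff p (Suc i)) i)"
    have coeff_dp: "coeff dp n = of_nat (Suc n) * coeff p (Suc n)" for n
      using coeff_eq_0[of p "Suc n"] p(2)
      by (auto simp: dp_def coeff_sum coeff_monom simp del: of_nat_Suc)
    have re_dp: "map_poly re dp = pderiv (map_poly re p)"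
    proof (rule poly_eqI)
      fix n
      have "re (of_nat k :: 'a dual) = of_nat k" for k by (induction k) simp_all
      thus "coeff (map_poly re dp) n = coeff (pderiv (map_poly re p)) n"
        by (simp add: coeff_map_poly coeff_pderiv coeff_dp del: of_nat_Suc)
    qed
    have "\<forall>i. coeff dp i \<in> G"
      using pG(1) ofnat D(4) by (simp add: coeff_dp del: of_nat_Suc)
    moreover have "coeff (pderiv (map_poly re p)) (d - 1) \<noteq> 0"
      using map0[OF pG(1,2)] d0 p(2) leading_coeff_0_iff[of "map_poly re p"]
      by (simp add: coeff_pderiv of_nat_eq_0_iff_char_dvd char del: of_nat_Suc leading_coeff_0_iff)
    hence "dp \<noteq> 0" using re_dp by auto
    ultimately have "A dp" using z re_dp by (auto simp: A_def p'_def)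
    from min[OF this] have "d \<le> degree dp" .
    moreover have "degree dp \<le> d - 1"
      using coeff_eq_0[of p] p(2) d0 by (intro degree_le) (auto simp: coeff_dp)
    hence "degree dp < d" using d0 by linarith
    ultimately show False by simp
  qed
  \<comment> \<open>The value forced on the derivative of \<open>z\<close> by differentiating \<open>p(z) = 0\<close>.\<close>
  define w where "w = - poly (map_poly eps p) z / p'"
  define \<zeta> where "\<zeta> = Dual z w"
  have root: "poly p \<zeta> = 0"
    using p' pG(3) by (intro dual.expand) (simp add: \<zeta>_def re_poly eps_poly w_def p'_def)
  define G' where "G' = {poly q \<zeta> | q. \<forall>i. coeff q i \<in> G}"
  have inj: "poly q \<zeta> = 0" if "\<forall>i. coeff q i \<in> G" "re (poly q \<zeta>) = 0" for q
    using that
  proof (induction "degree q" arbitrary: q rule: less_induct)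
    case less
    show ?case
    proof (cases "q = 0")
      case False
      have "A q" using less.prems False by (simp add: A_def re_poly \<zeta>_def)
      hence dq: "d \<le> degree q" by (rule min)
      have "re (lead_coeff p) \<noteq> 0" using pG(1,2) D(5) by (metis leading_coeff_0_iff)
      then obtain c where c: "c \<in> G" "c * lead_coeff p = 1"
        using maximal_deriv_graph_inverse[OF G max] pG(1) by blast
      define r where "r = q - monom (lead_coeff q * c) (degree q - d) * p"
      have rG: "\<forall>i. coeff r i \<in> G"
        using less.prems(1) c(1) pG(1) by (auto simp: r_def coeff_monom_mult intro!: cl)
      have rz: "poly r \<zeta> = poly q \<zeta>" by (simp add: r_def root)
      show ?thesis
      proof (cases "r = 0")
        case True thus ?thesis using rz by simp
      next
        case r0: False
        have "coeff r (degree q) = 0"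
          using dq c(2) p(2) by (simp add: r_def coeff_monom_mult mult.assoc)
        moreover have "degree r \<le> degree q"
          unfolding r_def
        proof (intro degree_diff_le order.trans[OF degree_mult_le])
          show "degree (monom (lead_coeff q * c) (degree q - d)) + degree p \<le> degree q"
            using dq p(2) degree_monom_le[of "lead_coeff q * c" "degree q - d"] by linarith
        qed simp
        ultimately have "degree r < degree q"
          using r0 by (metis le_neq_implies_less leading_coeff_0_iff)
        from less.hyps[OF this rG] show ?thesis using rz less.prems by simp
      qed
    qed simp
  qed
  have "deriv_graph G'"
    unfolding deriv_graph_def
  proof (intro conjI ballI impI)
    show "1 \<in> G'" unfolding G'_def using D(1,2) by (intro CollectI exI[of _ 1]) simp
  next
    fix a b assume "a \<in> G'" "b \<in> G'"
    then obtain q r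
      where q: "a = poly q \<zeta>" "\<forall>i. coeff q i \<in> G" "b = poly r \<zeta>" "\<forall>i. coeff r i \<in> G"
      unfolding G'_def by blast
    have sum: "(\<Sum>i\<in>I. f i) \<in> G" if "\<And>i. i \<in> I \<Longrightarrow> f i \<in> G" for f and I :: "nat set"
      using that by (induction I rule: infinite_finite_induct) (auto intro: cl)
    have "\<forall>i. coeff (q - r) i \<in> G" "\<forall>i. coeff (q * r) i \<in> G"
      using q by (auto simp: coeff_mult intro!: sum cl)
    thus "a - b \<in> G'" "a * b \<in> G'"
      unfolding G'_def q(1,3) by (auto simp flip: poly_diff poly_mult)
  next
    fix a assume "a \<in> G'" "re a = 0"
    thus "a = 0" unfolding G'_def using inj by blast
  qed
  moreover have "G \<subseteq> G'"
  proof
    fix g assume "g \<in> G"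
    thus "g \<in> G'" unfolding G'_def using D(1)
      by (intro CollectI exI[of _ "[:g:]"]) (simp add: coeff_pCons split: nat.split)
  qed
  ultimately have "G' = G" by (rule max)
  moreover have "\<zeta> \<in> G'" unfolding G'_def using D(1,2)
    by (intro CollectI exI[of _ "[:0, 1:]"]) (simp add: coeff_pCons split: nat.split)
  ultimately show ?thesis unfolding \<zeta>_def by (intro exI[of _ w]) simp
qed

text \<open>By Zorn's lemma there is a maximal single-valued extension of the given graph; by the
  preceding lemma it is defined everywhere.\<close>
theorem derivation_extends:
  fixes G0 :: "'a :: field dual set"
  assumes char: "CHAR('a) = 0" and G0: "deriv_graph G0"
    and alg: "\<And>z. \<exists>P. (\<forall>i. coeff P i \<in> G0) \<and> P \<noteq> 0 \<and> poly (map_poly re P) z = 0"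
  obtains D where "\<And>a b. D (a + b) = D a + D b" "\<And>a b. D (a * b) = a * D b + D a * b"
    "\<And>g. g \<in> G0 \<Longrightarrow> D (re g) = eps g"
proof -
  define Gs where "Gs = {G. deriv_graph G \<and> G0 \<subseteq> G}"
  have "\<exists>M\<in>Gs. \<forall>U\<in>Gs. M \<subseteq> U \<longrightarrow> U = M"
  proof (rule subset_Zorn_nonempty)
    show "Gs \<noteq> {}" using G0 by (auto simp: Gs_def)
  next
    fix Cs assume C: "Cs \<noteq> {}" "subset.chain Gs Cs"
    have sub: "\<And>U. U \<in> Cs \<Longrightarrow> deriv_graph U \<and> G0 \<subseteq> U"
      using C(2) by (auto simp: subset.chain_def Gs_def)
    have two: "\<exists>U\<in>Cs. a \<in> U \<and> b \<in> U" if "a \<in> \<Union>Cs" "b \<in> \<Union>Cs" for a b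
    proof -
      from that obtain U Y where UY: "U \<in> Cs" "a \<in> U" "Y \<in> Cs" "b \<in> Y" by blast
      hence "U \<subseteq> Y \<or> Y \<subseteq> U" using C(2) by (auto simp: subset.chain_def)
      thus ?thesis using UY by blast
    qed
    have "deriv_graph (\<Union>Cs)"
      unfolding deriv_graph_def
    proof (intro conjI ballI impI)
      obtain U where "U \<in> Cs" using C(1) by blast
      thus "1 \<in> \<Union>Cs" using sub deriv_graphD(2)[of U] by blast
    next
      fix a b assume "a \<in> \<Union>Cs" "b \<in> \<Union>Cs"
      then obtain U where U: "U \<in> Cs" "a \<in> U" "b \<in> U" using two by blast
      show "a - b \<in> \<Union>Cs" "a * b \<in> \<Union>Cs"
        using U sub[OF U(1)] deriv_graphD(3,4)[of U a b] by blast+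
    next
      fix a assume "a \<in> \<Union>Cs" "re a = 0"
      then obtain U where "U \<in> Cs" "a \<in> U" "re a = 0" by blast
      thus "a = 0" using sub[of U] deriv_graphD(5)[of U a] by simp
    qed
    thus "\<Union>Cs \<in> Gs" using C(1) sub by (auto simp: Gs_def)
  qed
  then obtain G where "G \<in> Gs" and mx: "\<And>U. U \<in> Gs \<Longrightarrow> G \<subseteq> U \<Longrightarrow> U = G"
    by metis
  hence G: "deriv_graph G" "G0 \<subseteq> G" by (simp_all add: Gs_def)
  have max: "U = G" if "deriv_graph U" "G \<subseteq> U" for U
    using mx[of U] that G(2) by (simp add: Gs_def)
  have "\<exists>w. Dual z w \<in> G" for z
  proof (rule maximal_deriv_graph_total[OF char G(1)])
    show "\<exists>P. (\<forall>i. coeff P i \<in> G) \<and> P \<noteq> 0 \<and> poly (map_poly re P) z = 0"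
      using alg[of z] G(2) by (meson subsetD)
  qed (rule max)
  then obtain D where D: "\<And>z. Dual z (D z) \<in> G" by metis
  have uniq: "w = D z" if "Dual z w \<in> G" for z w
  proof -
    have "Dual z w - Dual z (D z) = 0"
      by (intro deriv_graphD(5)[OF G(1)] deriv_graphD(3)[OF G(1)] that D) simp
    thus ?thesis by (metis dual.sel(2) eq_iff_diff_eq_0)
  qed
  show ?thesis
  proof (rule that[of D])
    fix a b
    have "Dual a (D a) + Dual b (D b) \<in> G" "Dual a (D a) * Dual b (D b) \<in> G"
      using D deriv_graphD(4,7)[OF G(1)] by blast+
    thus "D (a + b) = D a + D b" "D (a * b) = a * D b + D a * b"
      using uniq by (simp_all add: plus_dual_def times_dual_def)
  next
    fix g assume "g \<in> G0"
    thus "D (re g) = eps g" using uniq[of "re g" "eps g"] G(2) by auto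
  qed
qed

section \<open>Algebraic functions and their derivation\<close>

lemma map_poly_hom:
  fixes f :: "'a :: comm_ring_1 \<Rightarrow> 'b :: comm_ring_1"
  assumes add: "\<And>a b. f (a + b) = f a + f b" and mult: "\<And>a b. f (a * b) = f a * f b"
  shows "map_poly f (p + q) = map_poly f p + map_poly f q"
    and "map_poly f (p * q) = map_poly f p * map_poly f q"
proof -
  have f0: "f 0 = 0" using add[of 0 0] by simp
  show "map_poly f (p + q) = map_poly f p + map_poly f q"
    by (intro poly_eqI) (simp add: coeff_map_poly f0 add)
  have "f (\<Sum>i\<in>A. g i) = (\<Sum>i\<in>A. f (g i))" for A :: "nat set" and g
    by (induction A rule: infinite_finite_induct) (simp_all add: f0 add)
  thus "map_poly f (p * q) = map_poly f p * map_poly f q"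
    by (intro poly_eqI) (simp add: coeff_map_poly f0 coeff_mult mult)
qed

definition fun_of :: "complex poly \<Rightarrow> algfun" where
  "fun_of p = to_ac (to_fract p)"

lemma fun_of_simps [simp]:
  "fun_of 0 = 0" "fun_of 1 = 1" "fun_of (p + q) = fun_of p + fun_of q"
  "fun_of (p - q) = fun_of p - fun_of q" "fun_of (p * q) = fun_of p * fun_of q"
  "fun_of (- p) = - fun_of p" "fun_of (p ^ n) = fun_of p ^ n"
  "fun_of p = fun_of q \<longleftrightarrow> p = q" "fun_of p = 0 \<longleftrightarrow> p = 0"
  by (induction n) (simp_all add: fun_of_def)

lemma fun_of_const: "fun_of [:c:] = af_const c"
  by (simp add: fun_of_def af_const_def)

lemma fun_of_X: "fun_of [:0, 1:] = af_x"
  by (simp add: fun_of_def af_x_def)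

lemma fun_of_of_nat: "fun_of (of_nat n) = of_nat n"
  by (induction n) simp_all

lemma CHAR_algfun: "CHAR(algfun) = 0"
proof -
  have "of_nat n \<noteq> (0 :: algfun)" if "n > 0" for n
    using that fun_of_simps(9)[of "of_nat n"] by (simp add: fun_of_of_nat)
  thus ?thesis unfolding CHAR_eq0_iff by blast
qed

lemma fun_of_sum: "fun_of (\<Sum>i\<in>A. f i) = (\<Sum>i\<in>A. fun_of (f i))"
  by (induction A rule: infinite_finite_induct) simp_all

lemma af_const_simps [simp]:
  "af_const 0 = 0" "af_const 1 = 1" "af_const (a + b) = af_const a + af_const b"
  "af_const (a - b) = af_const a - af_const b" "af_const (a * b) = af_const a * af_const b"
  "af_const (- a) = - af_const a" "af_const (a ^ n) = af_const a ^ n"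
  "af_const a = af_const b \<longleftrightarrow> a = b" "af_const a = 0 \<longleftrightarrow> a = 0"
proof -
  have "[:a * b:] = [:a:] * [:b:]" "[:a + b:] = [:a:] + [:b:]"
    "[:a - b:] = [:a:] - [:b:]" "[:- a:] = - [:a:]" by simp_all
  thus "af_const (a + b) = af_const a + af_const b"
    "af_const (a - b) = af_const a - af_const b" "af_const (a * b) = af_const a * af_const b"
    "af_const (- a) = - af_const a"
    by (metis fun_of_const fun_of_simps(3-6))+
  have "[:a ^ n:] = [:a:] ^ n" by (simp add: poly_const_pow)
  thus "af_const (a ^ n) = af_const a ^ n" by (metis fun_of_const fun_of_simps(7))
  show "af_const a = af_const b \<longleftrightarrow> a = b" "af_const a = 0 \<longleftrightarrow> a = 0" "af_const 0 = 0" "af_const 1 = 1"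
    using fun_of_simps(8)[of "[:a:]" "[:b:]"] fun_of_simps(9)[of "[:a:]"] fun_of_const[of 1]
    by (simp_all add: fun_of_const af_const_def one_pCons[symmetric])
qed

lemma af_eval_simps [simp]:
  "af_eval 0 z = 0" "af_eval 1 z = 1" "af_eval (p + q) z = af_eval p z + af_eval q z"
  "af_eval (p - q) z = af_eval p z - af_eval q z" "af_eval (p * q) z = af_eval p z * af_eval q z"
  "af_eval (- p) z = - af_eval p z" "af_eval (p ^ n) z = af_eval p z ^ n"
  "af_eval (pCons c p) z = af_const c + z * af_eval p z"
proof -
  note hom = map_poly_hom[of af_const, OF af_const_simps(3,5)]
  show 1: "af_eval 1 z = 1" by (simp add: af_eval_def)
  show a: "af_eval (p + q) z = af_eval p z + af_eval q z"
    and m: "af_eval (p * q) z = af_eval p z * af_eval q z" for p q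
    by (simp_all add: af_eval_def hom)
  show 0: "af_eval 0 z = 0" by (simp add: af_eval_def)
  show u: "af_eval (- p) z = - af_eval p z" for p
    using a[of p "- p"] 0 by (simp add: eq_neg_iff_add_eq_0 add.commute)
  show "af_eval (p - q) z = af_eval p z - af_eval q z"
    using a[of p "- q"] u by simp
  show "af_eval (p ^ n) z = af_eval p z ^ n" by (induction n) (simp_all add: 1 m)
  show "af_eval (pCons c p) z = af_const c + z * af_eval p z"
    by (simp add: af_eval_def map_poly_pCons)
qed

lemma af_eval_numeral [simp]: "af_eval (numeral n) z = numeral n"
proof -
  have "af_eval (of_nat k) z = of_nat k" for k by (induction k) simp_all
  from this[of "numeral n"] show ?thesis by simp
qed

lemma af_eval_x [simp]: "af_eval p af_x = fun_of p"
proof (induction p)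
  case (pCons c p)
  have "pCons c p = [:c:] + [:0, 1:] * p" by simp
  hence "fun_of (pCons c p) = af_const c + af_x * fun_of p"
    by (metis fun_of_simps(3,5) fun_of_const fun_of_X)
  thus ?case using pCons by simp
qed simp

lemma af_eval_pcompose: "af_eval (pcompose p q) z = af_eval p (af_eval q z)"
  by (induction p) (simp_all add: pcompose_pCons)

lemma af_eval_eq_0_imp_const:
  assumes "p \<noteq> 0" "af_eval p z = 0"
  shows "\<exists>c. z = af_const c"
  using assms
proof (induction "degree p" arbitrary: p)
  case 0
  then obtain c where "p = [:c:]" "c \<noteq> 0" by (metis degree_eq_zeroE pCons_0_0)
  thus ?case using 0 by simp
next
  case (Suc n)
  have "\<not> constant (poly p)" using Suc by (simp add: constant_degree)
  then obtain a where "poly p a = 0" using fundamental_theorem_of_algebra by blast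
  then obtain q where q: "p = [:- a, 1:] * q" by (metis dvdE poly_eq_0_iff_dvd)
  have q0: "q \<noteq> 0" "degree q = n" using Suc(2,3) q by (auto simp: degree_mult_eq simp del: mult_pCons_left)
  have "(z - af_const a) * af_eval q z = 0" using Suc(4) unfolding q af_eval_simps by simp
  thus ?case using Suc(1)[of q] q0 by auto
qed

text \<open>A polynomial in two variables is a polynomial in \<open>T\<close> over \<open>\<complex>[x]\<close>; \<open>x\<close> stays
  the variable of the ground field and \<open>T\<close> is specialised.\<close>
definition bieval :: "complex poly poly \<Rightarrow> algfun \<Rightarrow> algfun" where
  "bieval P z = poly (map_poly fun_of P) z"

lemma bieval_simps [simp]:
  "bieval 0 z = 0" "bieval 1 z = 1" "bieval (P + Q) z = bieval P z + bieval Q z"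
  "bieval (P * Q) z = bieval P z * bieval Q z" "bieval (P - Q) z = bieval P z - bieval Q z"
  "bieval (pCons a P) z = fun_of a + z * bieval P z"
  "bieval (smult a P) z = fun_of a * bieval P z"
proof -
  note hom = map_poly_hom[of fun_of, OF fun_of_simps(3,5)]
  show a: "bieval (P + Q) z = bieval P z + bieval Q z" for P Q by (simp add: bieval_def hom)
  show "bieval (P - Q) z = bieval P z - bieval Q z" using a[of "P - Q" Q] by simp
  show m: "bieval (P * Q) z = bieval P z * bieval Q z" for P Q by (simp add: bieval_def hom)
  show c: "bieval (pCons a P) z = fun_of a + z * bieval P z" for a P
    by (simp add: bieval_def map_poly_pCons)
  show "bieval 0 z = 0" "bieval 1 z = 1" by (simp_all add: bieval_def)
  thus "bieval (smult a P) z = fun_of a * bieval P z"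
    using m[of "[:a:]" P] c[of a 0] by simp
qed

lemma bieval_altdef: "degree P \<le> n \<Longrightarrow> bieval P z = (\<Sum>i\<le>n. fun_of (coeff P i) * z ^ i)"
proof -
  assume "degree P \<le> n"
  hence "degree (map_poly fun_of P) \<le> n" using map_poly_degree_leq order.trans by blast
  moreover have "poly Q z = (\<Sum>i\<le>n. coeff Q i * z ^ i)" if "degree Q \<le> n" for Q :: "algfun poly"
    using that unfolding poly_altdef by (intro sum.mono_neutral_left) (auto simp: coeff_eq_0)
  ultimately show ?thesis by (simp add: bieval_def coeff_map_poly)
qed

lemma algebraic_over_polys: "\<exists>P. P \<noteq> 0 \<and> bieval P z = 0"
proof -
  obtain p :: "complex poly fract poly" where p: "p \<noteq> 0" "poly (map_poly to_ac p) z = 0"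
    by (rule alg_closure_algebraic)
  obtain c P where cP: "p = smult c (map_poly to_fract P)" by (rule content_decompose_fract)
  have "map_poly to_ac p = smult (to_ac c) (map_poly fun_of P)"
    by (intro poly_eqI) (simp add: cP coeff_map_poly fun_of_def)
  hence "bieval P z = 0" "P \<noteq> 0" using p cP by (auto simp: bieval_def)
  thus ?thesis by blast
qed

lemma ex_af_deriv:
  "\<exists>D. (\<forall>a b. D (a + b) = D a + D b) \<and> (\<forall>a b. D (a * b) = a * D b + D a * b) \<and>
     (\<forall>p. D (fun_of p) = fun_of (pderiv p))"
proof -
  define f where "f = (\<lambda>p. Dual (fun_of p) (fun_of (pderiv p)))"
  have f: "f p - f q = f (p - q)" "f p * f q = f (p * q)" "f 0 = 0" "f 1 = 1" for p q
    by (simp_all add: f_def minus_dual_def times_dual_def pderiv_diff pderiv_mult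
        zero_dual_def one_dual_def pderiv_1 algebra_simps)
  show ?thesis
  proof (rule derivation_extends[of "range f"])
    show "CHAR(algfun) = 0" by (rule CHAR_algfun)
  next
    show "deriv_graph (range f)"
      unfolding deriv_graph_def
    proof (intro conjI ballI impI)
      show "1 \<in> range f" by (metis f(4) rangeI)
    next
      fix a assume "a \<in> range f" "re a = 0"
      then obtain p where "a = f p" "p = 0" by (auto simp: f_def)
      thus "a = 0" using f(3) by simp
    qed (auto simp: f)
  next
    fix z :: algfun
    obtain P where P: "P \<noteq> 0" "bieval P z = 0" using algebraic_over_polys by blast
    have "map_poly re (map_poly f P) = map_poly fun_of P"
      by (intro poly_eqI) (simp add: coeff_map_poly f, simp add: f_def)
    moreover have "map_poly f P \<noteq> 0"
    proof
      assume "map_poly f P = 0"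
      hence "f (coeff P i) = 0" for i using f(3) by (metis coeff_0 coeff_map_poly)
      hence "coeff P i = 0" for i by (simp add: f_def zero_dual_def)
      thus False using P(1) by (simp add: poly_eq_iff)
    qed
    ultimately show "\<exists>P. (\<forall>i. coeff P i \<in> range f) \<and> P \<noteq> 0 \<and> poly (map_poly re P) z = 0"
      using P(2) by (intro exI[of _ "map_poly f P"]) (auto simp: coeff_map_poly f bieval_def)
  next
    fix D assume D: "\<And>a b. D (a + b) = D a + D b" "\<And>a b. D (a * b) = a * D b + D a * b"
      "\<And>g. g \<in> range f \<Longrightarrow> D (re g) = eps g"
    have "D (fun_of p) = fun_of (pderiv p)" for p using D(3)[of "f p"] by (simp add: f_def)
    thus ?thesis using D(1,2) by blast
  qed
qed

text \<open>The derivation \<open>d/dx\<close> of \<open>\<complex>[x]\<close>, extended to all algebraic functions.\<close>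
definition af_deriv :: "algfun \<Rightarrow> algfun" where
  "af_deriv = (SOME D. (\<forall>a b. D (a + b) = D a + D b) \<and> (\<forall>a b. D (a * b) = a * D b + D a * b) \<and>
     (\<forall>p. D (fun_of p) = fun_of (pderiv p)))"

lemma af_deriv_basic:
  "af_deriv (a + b) = af_deriv a + af_deriv b"
  "af_deriv (a * b) = a * af_deriv b + af_deriv a * b"
  "af_deriv (fun_of p) = fun_of (pderiv p)"
  using someI_ex[OF ex_af_deriv] unfolding af_deriv_def by blast+

lemma af_deriv_simps [simp]:
  "af_deriv 0 = 0" "af_deriv 1 = 0" "af_deriv (af_const c) = 0" "af_deriv af_x = 1"
  "af_deriv (- a) = - af_deriv a" "af_deriv (a - b) = af_deriv a - af_deriv b"
proof -
  show "af_deriv 0 = 0" "af_deriv 1 = 0" "af_deriv (af_const c) = 0" "af_deriv af_x = 1"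
    using af_deriv_basic(3)[of 0] af_deriv_basic(3)[of 1] af_deriv_basic(3)[of "[:c:]"]
      af_deriv_basic(3)[of "[:0, 1:]"]
    by (simp_all add: fun_of_const fun_of_X pderiv_pCons pderiv_1)
  thus u: "af_deriv (- a) = - af_deriv a" for a
    using af_deriv_basic(1)[of a "- a"] by (simp add: eq_neg_iff_add_eq_0 add.commute)
  show "af_deriv (a - b) = af_deriv a - af_deriv b"
    using af_deriv_basic(1)[of a "- b"] u by simp
qed

lemma af_deriv_sum: "af_deriv (\<Sum>i\<in>A. f i) = (\<Sum>i\<in>A. af_deriv (f i))"
  by (induction A rule: infinite_finite_induct) (simp_all add: af_deriv_basic)

lemma af_deriv_power: "af_deriv (a ^ n) = of_nat n * a ^ (n - 1) * af_deriv a"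
proof (induction n)
  case (Suc n)
  have "of_nat n * (a ^ (n - 1) * a) = of_nat n * a ^ n"
    using power_minus_mult[of n a] by (cases "n = 0") simp_all
  moreover have "a * (of_nat n * a ^ (n - 1) * af_deriv a) = of_nat n * (a ^ (n - 1) * a) * af_deriv a"
    by (simp only: mult_ac)
  ultimately have "a * af_deriv (a ^ n) = of_nat n * a ^ n * af_deriv a"
    by (simp only: Suc)
  thus ?case by (simp add: af_deriv_basic distrib_right)
qed simp

lemma af_deriv_divide:
  assumes "b \<noteq> 0"
  shows "af_deriv (a / b) = (af_deriv a * b - a * af_deriv b) / b\<^sup>2"
proof -
  have "af_deriv a = a / b * af_deriv b + af_deriv (a / b) * b"
    using af_deriv_basic(2)[of "a / b" b] assms by simp
  hence "af_deriv a * b - a * af_deriv b = af_deriv (a / b) * b\<^sup>2"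
    using assms by (simp add: algebra_simps power2_eq_square)
  thus ?thesis using assms by simp
qed

lemma af_deriv_af_eval: "af_deriv (af_eval p z) = af_eval (pderiv p) z * af_deriv z"
  by (induction p) (simp_all add: af_deriv_basic pderiv_pCons algebra_simps)

lemma af_deriv_bieval_const:
  assumes "af_deriv z = 0"
  shows "af_deriv (bieval P z) = bieval (map_poly pderiv P) z"
  using assms by (induction P) (simp_all add: af_deriv_basic map_poly_pCons)

text \<open>An algebraic function with derivative \<open>0\<close> satisfies every equation obtained from its own
  equation by differentiating the coefficients, hence one with constant coefficients.\<close>
theorem af_deriv_eq_0_imp_const:
  assumes D: "af_deriv z = 0"
  shows "\<exists>c. z = af_const c"
proof -
  define A where "A = (\<lambda>k P. P \<noteq> 0 \<and> bieval P z = 0 \<and> (\<forall>i. degree (coeff P i) \<le> k))"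
  obtain P where P: "P \<noteq> 0" "bieval P z = 0" using algebraic_over_polys by blast
  have "degree (coeff P i) \<le> (\<Sum>i\<le>degree P. degree (coeff P i))" for i
    by (cases "i \<le> degree P")
       (auto intro!: member_le_sum[of i _ "\<lambda>i. degree (coeff P i)"] simp: coeff_eq_0)
  hence ex: "\<exists>k P. A k P" using P unfolding A_def by blast
  define k where "k = (LEAST k. \<exists>P. A k P)"
  obtain P where AP: "A k P" using LeastI_ex[OF ex] unfolding k_def by blast
  have min: "k \<le> l" if "A l Q" for l Q
    unfolding k_def using that by (intro Least_le) blast
  have "k = 0"
  proof (rule ccontr)
    assume k: "k \<noteq> 0"
    define Q where "Q = map_poly pderiv P"
    have deg: "degree (coeff Q i) \<le> k - 1" for i
      using AP unfolding A_def Q_def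
      by (simp add: coeff_map_poly degree_pderiv diff_le_mono)
    have "bieval Q z = 0"
      using af_deriv_bieval_const[OF D, of P] AP by (simp add: Q_def A_def)
    hence "Q = 0" using min[of "k - 1" Q] deg k unfolding A_def by fastforce
    hence "pderiv (coeff P i) = 0" for i
      unfolding Q_def by (metis coeff_0 coeff_map_poly pderiv_0)
    hence "A 0 P" using AP by (auto simp: A_def pderiv_eq_0_iff)
    thus False using min[of 0 P] k by simp
  qed
  define p where "p = map_poly (\<lambda>q. coeff q 0) P"
  have co: "coeff P i = [:coeff p i:]" for i
    using AP \<open>k = 0\<close> unfolding A_def p_def
    by (simp add: coeff_map_poly) (metis degree_eq_zeroE coeff_pCons_0)
  have "map_poly fun_of P = map_poly af_const p"
    by (intro poly_eqI) (simp add: coeff_map_poly co fun_of_const)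
  hence "af_eval p z = 0" using AP by (simp add: A_def bieval_def af_eval_def)
  moreover have "p \<noteq> 0"
  proof
    assume "p = 0"
    hence "P = 0" by (intro poly_eqI) (simp add: co)
    thus False using AP by (simp add: A_def)
  qed
  ultimately show ?thesis by (rule af_eval_eq_0_imp_const[rotated])
qed

section \<open>Relations between functions with simple logarithmic derivatives\<close>

text \<open>The functions of complexity level \<open>k\<close>: a field operation or a differentiation costs one
  level. In the application a level multiplies the weights by \<open>4\<close>, so an argument that uses a
  bounded number of levels enlarges them by a bounded factor only.\<close>
locale complexity_filtration =
  fixes Q :: "nat \<Rightarrow> algfun set"
  assumes mono: "k \<le> l \<Longrightarrow> Q k \<subseteq> Q l"
    and const: "af_const c \<in> Q k"
    and mult: "a \<in> Q k \<Longrightarrow> b \<in> Q k \<Longrightarrow> a * b \<in> Q (Suc k)"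
    and add: "a \<in> Q k \<Longrightarrow> b \<in> Q k \<Longrightarrow> a + b \<in> Q (Suc k)"
    and inverse: "a \<in> Q k \<Longrightarrow> inverse a \<in> Q k"
    and deriv: "a \<in> Q k \<Longrightarrow> af_deriv a \<in> Q (Suc k)"
begin

lemma up: "a \<in> Q k \<Longrightarrow> k \<le> l \<Longrightarrow> a \<in> Q l"
  using mono by blast

lemma divide: "a \<in> Q k \<Longrightarrow> b \<in> Q k \<Longrightarrow> a / b \<in> Q (Suc k)"
  unfolding divide_inverse by (intro mult inverse)

lemma diff:
  assumes "a \<in> Q k" "b \<in> Q k"
  shows "a - b \<in> Q (Suc (Suc k))"
proof -
  have "af_const (- 1) * b \<in> Q (Suc k)" by (intro mult const assms)
  from add[OF up[OF assms(1)] this] show ?thesis by simp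
qed

lemma pivot_coeff:
  assumes Q: "a \<in> Q k" "b \<in> Q k" "l \<in> Q k" "l' \<in> Q k"
  shows "af_deriv a + a * l - a * (af_deriv b / b + l') \<in> Q (k + 6)"
proof -
  have "af_deriv a + a * l \<in> Q (Suc (Suc k))" by (intro add deriv mult Q)
  moreover have "af_deriv b / b \<in> Q (Suc (Suc k))"
    by (intro divide deriv up[OF Q(2)] Q) simp
  hence "af_deriv b / b + l' \<in> Q (Suc (Suc (Suc k)))"
    by (intro add up[OF Q(4)]) simp_all
  hence "a * (af_deriv b / b + l') \<in> Q (Suc (Suc (Suc (Suc k))))"
    by (intro mult up[OF Q(1)]) simp_all
  ultimately have "af_deriv a + a * l - a * (af_deriv b / b + l')
      \<in> Q (Suc (Suc (Suc (Suc (Suc (Suc k))))))"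
    by (intro diff) (rule up, assumption, simp)
  thus ?thesis by (rule up) simp
qed

text \<open>Call two terms equivalent if their quotient has small complexity. Then every linear
  relation with coefficients of small complexity holds already on each equivalence class.
  This replaces a Wronskian argument: dividing by the \<open>p\<close>-th term and differentiating
  removes that term; by induction the derivative of each class sum \<open>S\<close> not containing \<open>p\<close>,
  divided by the \<open>p\<close>-th term, is \<open>0\<close>, so \<open>S\<close> is a constant multiple of the \<open>p\<close>-th term. If
  the constant were nonzero, this would be a shorter relation in which \<open>p\<close> forms a class of
  its own, or, if there is nothing else, the two classes would be linked after all.\<close>
theorem relation_splits_along_classes:
  assumes "finite I" and eq: "equivp E"
    and f0: "\<And>i. i \<in> I \<Longrightarrow> f i \<noteq> 0"
    and logd: "\<And>i. i \<in> I \<Longrightarrow> af_deriv (f i) / f i \<in> Q 0"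
    and E: "\<And>i j. i \<in> I \<Longrightarrow> j \<in> I \<Longrightarrow> f i / f j \<in> Q K \<Longrightarrow> E i j"
    and "\<And>i. i \<in> I \<Longrightarrow> a i \<in> Q k" "k + 6 * card I \<le> K" "(\<Sum>i\<in>I. a i * f i) = 0" "j \<in> I"
  shows "(\<Sum>i\<in>{i\<in>I. E i j}. a i * f i) = 0"
  using assms
proof (induction "card I" arbitrary: I a j k rule: less_induct)
  case (less I a j k)
  note fin = less.prems(1) and f0 = less.prems(3) and logd = less.prems(4) and E = less.prems(5)
    and aQ = less.prems(6) and kK = less.prems(7) and rel = less.prems(8)
  have refl: "E i i" and sym: "E i j \<Longrightarrow> E j i" and trans: "E i j \<Longrightarrow> E j k \<Longrightarrow> E i k" for i j k
    using equivp_reflp[OF eq] equivp_symp[OF eq] equivp_transp[OF eq] by blast+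
  have card0: "card I > 0" using less.prems(1,9) by (auto simp: card_gt_0_iff)
  \<comment> \<open>Dividing the relation by its \<open>p\<close>-th term and differentiating gives a shorter one.\<close>
  have pivot: "\<exists>c. (\<Sum>i\<in>{i\<in>I. E i q}. a i * f i) = af_const c * (a p * f p)"
    if p: "p \<in> I" "a p \<noteq> 0" and q: "q \<in> I" "\<not> E p q" for p q
  proof -
    define \<mu> where "\<mu> = af_deriv (a p) / a p + af_deriv (f p) / f p"
    define b where "b = (\<lambda>i. af_deriv (a i) + a i * (af_deriv (f i) / f i) - a i * \<mu>)"
    define u where "u = a p * f p"
    have u0: "u \<noteq> 0" using p f0 by (simp add: u_def)
    have bf: "b i * f i = af_deriv (a i * f i) - a i * f i * \<mu>" if "i \<in> I" for i
    proof -
      have "af_deriv (f i) / f i * f i = af_deriv (f i)" using f0[OF that] by simp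
      hence "a i * (af_deriv (f i) / f i) * f i = a i * af_deriv (f i)" by (simp only: mult.assoc)
      thus ?thesis unfolding b_def af_deriv_basic
        by (simp only: left_diff_distrib distrib_right) (simp only: mult_ac add_ac)
    qed
    have Du: "af_deriv u = u * \<mu>"
    proof -
      have "a p * (af_deriv (a p) / a p) = af_deriv (a p)" "f p * (af_deriv (f p) / f p) = af_deriv (f p)"
        using f0[OF p(1)] p(2) by simp_all
      moreover have "u * \<mu> = a p * (af_deriv (a p) / a p) * f p + a p * (f p * (af_deriv (f p) / f p))"
        unfolding u_def \<mu>_def distrib_left by (simp only: mult_ac)
      ultimately show ?thesis unfolding u_def af_deriv_basic by (simp only: add.commute)
    qed
    have bsum: "(\<Sum>i\<in>A. b i * f i) = af_deriv (\<Sum>i\<in>A. a i * f i) - (\<Sum>i\<in>A. a i * f i) * \<mu>"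
      if "A \<subseteq> I" for A
    proof -
      have "(\<Sum>i\<in>A. b i * f i) = (\<Sum>i\<in>A. af_deriv (a i * f i) - a i * f i * \<mu>)"
        using that bf by (intro sum.cong) auto
      thus ?thesis by (simp add: sum_subtractf af_deriv_sum sum_distrib_right)
    qed
    have "b p * f p = 0" using bf[OF p(1)] Du by (simp add: u_def)
    hence "(\<Sum>i\<in>I - {p}. b i * f i) = (\<Sum>i\<in>I. b i * f i)"
      using sum.remove[OF fin p(1), of "\<lambda>i. b i * f i"] by simp
    also have "\<dots> = 0" using bsum[of I] rel by simp
    finally have rel': "(\<Sum>i\<in>I - {p}. b i * f i) = 0" .
    have bQ: "b i \<in> Q (k + 6)" if "i \<in> I" for i
      unfolding b_def \<mu>_def
      by (intro pivot_coeff aQ up[OF logd, of _ k] that p(1)) simp_all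
    have "(\<Sum>i\<in>{i\<in>I - {p}. E i q}. b i * f i) = 0"
    proof (rule less.hyps[of "I - {p}" b "k + 6"])
      show "card (I - {p}) < card I" using p fin card0 by simp
      show "k + 6 + 6 * card (I - {p}) \<le> K" using kK p fin card0 by (simp add: card_Diff_singleton)
      show "equivp E" by (rule eq)
      show "q \<in> I - {p}" using q refl by blast
    qed (use fin f0 logd E bQ rel' in blast)+
    moreover have "{i\<in>I - {p}. E i q} = {i\<in>I. E i q}" using q(2) by auto
    moreover define S where "S = (\<Sum>i\<in>{i\<in>I. E i q}. a i * f i)"
    ultimately have S: "af_deriv S = S * \<mu>"
      using bsum[of "{i\<in>I. E i q}"] by simp
    have "af_deriv (S / u) = 0" using S Du u0 by (simp add: af_deriv_divide)
    then obtain c where "S / u = af_const c" using af_deriv_eq_0_imp_const by blast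
    hence "S = af_const c * u" using u0 by (simp add: divide_eq_eq)
    thus ?thesis unfolding S_def u_def by blast
  qed
  define J where "J = {i\<in>I. E i j}"
  show ?case
  proof (rule ccontr)
    assume "(\<Sum>i\<in>{i\<in>I. E i j}. a i * f i) \<noteq> 0"
    hence S: "(\<Sum>i\<in>J. a i * f i) \<noteq> 0" by (simp add: J_def)
    have "\<exists>p\<in>I - J. a p \<noteq> 0"
    proof (rule ccontr)
      assume "\<not> (\<exists>p\<in>I - J. a p \<noteq> 0)"
      hence "(\<Sum>i\<in>J. a i * f i) = (\<Sum>i\<in>I. a i * f i)"
        using fin by (intro sum.mono_neutral_left) (auto simp: J_def)
      thus False using rel S by simp
    qed
    then obtain p where p: "p \<in> I" "p \<notin> J" "a p \<noteq> 0" by blast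
    have pj: "\<not> E p j" using p by (simp add: J_def)
    have cls: "\<not> E i p" if "i \<in> J" for i
    proof
      assume "E i p"
      moreover have "E i j" using that by (simp add: J_def)
      ultimately show False using pj trans sym by blast
    qed
    obtain c where c: "(\<Sum>i\<in>J. a i * f i) = af_const c * (a p * f p)"
      using pivot[OF p(1,3) less.prems(9) pj] by (auto simp: J_def)
    show False
    proof (cases "insert p J = I")
      case False
      define a' where "a' = a(p := - af_const c * a p)"
      have sub: "insert p J \<subset> I" using False p by (auto simp: J_def)
      have finJ: "finite J" using fin by (simp add: J_def)
      have "(\<Sum>i\<in>J. a' i * f i) = (\<Sum>i\<in>J. a i * f i)"
        using p by (intro sum.cong) (auto simp: a'_def)
      hence rel': "(\<Sum>i\<in>insert p J. a' i * f i) = 0"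
        using c p finJ by (simp add: a'_def)
      have "af_const (- c) * a p \<in> Q (Suc k)" using mult[OF const aQ[OF p(1)]] .
      hence aQ': "a' i \<in> Q (Suc k)" if "i \<in> I" for i
        using aQ that up[of _ k "Suc k"] by (simp add: a'_def)
      have cl: "card (insert p J) < card I" using sub fin by (simp add: psubset_card_mono)
      have "(\<Sum>i\<in>{i\<in>insert p J. E i p}. a' i * f i) = 0"
      proof (rule less.hyps[OF cl, of a' "Suc k"])
        show "Suc k + 6 * card (insert p J) \<le> K" using kK cl by linarith
        show "equivp E" by (rule eq)
        show "finite (insert p J)" using finJ by simp
      qed (use sub f0 logd E rel' aQ' in blast)+
      moreover have "{i\<in>insert p J. E i p} = {p}" using cls refl by auto
      ultimately have "a' p * f p = 0" by simp
      hence "af_const c * (a p * f p) = 0" by (simp add: a'_def)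
      thus False using c S by simp
    next
      case True
      obtain i where i: "i \<in> J" "a i \<noteq> 0"
        using sum.not_neutral_contains_not_neutral[OF S] by (metis mult_zero_left)
      have "i \<in> I" using i by (simp add: J_def)
      have cl: "{l\<in>I. E l p} = {p}" using True cls refl by blast
      obtain c' where "a p * f p = af_const c' * (a i * f i)"
        using pivot[OF \<open>i \<in> I\<close> i(2) p(1) cls[OF i(1)]] unfolding cl by auto
      hence "f p / f i = af_const c' * (a i / a p)"
        using f0[OF \<open>i \<in> I\<close>] p(3) by (simp add: divide_eq_eq mult_ac eq_divide_eq)
      moreover have "\<dots> \<in> Q (Suc (Suc k))"
        using \<open>i \<in> I\<close> p(1) by (intro mult const divide aQ)
      ultimately have "f p / f i \<in> Q (Suc (Suc k))" by simp
      hence "f p / f i \<in> Q K" by (rule up) (use kK card0 in linarith)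
      hence "E p i" using E p(1) \<open>i \<in> I\<close> by blast
      thus False using cls[OF i(1)] sym by blast
    qed
  qed
qed

text \<open>If no proper subsum vanishes, the classes of the preceding theorem must be trivial, so
  any two terms are linked by a chain of quotients of small complexity. The equivalence
  relation is the transitive closure of \<open>R\<close>, whence the extra \<open>card I * card I\<close>, a bound for
  the length of a chain.\<close>
theorem ratio_in_filtration:
  assumes fin: "finite I"
    and logd: "\<And>i. i \<in> I \<Longrightarrow> af_deriv (f i) / f i \<in> Q 0"
    and rel: "(\<Sum>i\<in>I. f i) = 0"
    and nosub: "\<And>J. J \<noteq> {} \<Longrightarrow> J \<subset> I \<Longrightarrow> (\<Sum>i\<in>J. f i) \<noteq> 0"
    and f0: "\<And>i. i \<in> I \<Longrightarrow> f i \<noteq> 0"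
    and ij: "i \<in> I" "j \<in> I"
  shows "f i / f j \<in> Q (6 * card I + card I * card I)"
proof -
  define K where "K = 6 * card I"
  define R where "R = {(i, j). i \<in> I \<and> j \<in> I \<and> f i / f j \<in> Q K}"
  define E where "E = (\<lambda>i j. (i, j) \<in> R\<^sup>*)"
  have "sym R"
  proof (rule symI)
    fix i j assume "(i, j) \<in> R"
    thus "(j, i) \<in> R" unfolding R_def using inverse[of "f i / f j" K] by simp
  qed
  hence eq: "equivp E"
  proof (intro equivpI reflpI sympI transpI)
    show "E l l" for l by (simp add: E_def)
    show "E l i" if "E i l" for i l
      using that symD[OF sym_rtrancl[OF \<open>sym R\<close>]] by (simp add: E_def)
    show "E i l" if "E i j" "E j l" for i j l
      using that rtrancl_trans[of i j R l] by (simp add: E_def)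
  qed
  have "(\<Sum>l\<in>{l\<in>I. E l j}. 1 * f l) = 0"
  proof (rule relation_splits_along_classes[OF fin eq, where k = 0 and K = K])
    show "1 \<in> Q 0" using const[of 1] by simp
    show "E i j" if "i \<in> I" "j \<in> I" "f i / f j \<in> Q K" for i j
      using that by (auto simp: E_def R_def)
  qed (use f0 logd rel ij in \<open>simp_all add: K_def\<close>)
  hence "{l\<in>I. E l j} = I"
    using nosub[of "{l\<in>I. E l j}"] ij(2) equivp_reflp[OF eq, of j] by fastforce
  hence "(i, j) \<in> R\<^sup>*" using ij unfolding E_def by blast
  moreover have finR: "finite R"
    by (rule finite_subset[of _ "I \<times> I"]) (use fin in \<open>auto simp: R_def\<close>)
  ultimately obtain n where n: "(i, j) \<in> R ^^ n" "n \<le> card R"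
    unfolding rtrancl_finite_eq_relpow[OF finR] by blast
  have path: "f i / f j \<in> Q (K + n)" if "(i, j) \<in> R ^^ n" "i \<in> I" for n i j
    using that
  proof (induction n arbitrary: j)
    case 0
    thus ?case using const[of 1] f0 by simp
  next
    case (Suc n)
    then obtain l where l: "(i, l) \<in> R ^^ n" "(l, j) \<in> R" by auto
    have "f l / f j \<in> Q (K + n)" using l(2) up[of _ K "K + n"] by (simp add: R_def)
    hence "f i / f l * (f l / f j) \<in> Q (Suc (K + n))"
      by (rule mult[OF Suc.IH[OF l(1) Suc.prems(2)]])
    moreover have "f i / f l * (f l / f j) = f i / f j" using l f0 by (simp add: R_def)
    ultimately show ?case by (simp only: add_Suc_right)
  qed
  have "card R \<le> card I * card I"
    using card_mono[of "I \<times> I" R] fin by (auto simp: R_def card_cartesian_product)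
  thus ?thesis using up[OF path[OF n(1) ij(1)]] n(2) by (simp add: K_def)
qed

end

section \<open>The weight filtration on \<open>\<complex>[x, y, s, r]\<close>\<close>

text \<open>The setting at a conjugate point \<open>y\<close> of \<open>x\<close>; \<open>s\<close> and \<open>r\<close> are square roots of the
  discriminant at \<open>x\<close> and at \<open>y\<close>. They generate, with \<open>x\<close> and \<open>y\<close>, a ring whose quotient field
  contains both splitting fields of the characteristic polynomial.\<close>
locale conjugate_point =
  fixes h \<Delta> :: "complex poly" and y s r :: algfun
  assumes deg_h: "degree h > 0"
    and h_y: "af_eval h y = fun_of h"
    and \<Delta>_nz: "\<Delta> \<noteq> 0"
    and s_sq: "s\<^sup>2 = fun_of \<Delta>"
    and r_sq: "r\<^sup>2 = af_eval \<Delta> y"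
begin

abbreviation "m \<equiv> degree h"
abbreviation "e \<equiv> degree \<Delta>"

text \<open>\<open>V k\<close> holds for the polynomial expressions in \<open>x\<close>, \<open>y\<close>, \<open>s\<close>, \<open>r\<close> of weight at most \<open>k\<close>. The weight
  \<open>e\<close> of the square roots is chosen so that replacing \<open>s\<^sup>2\<close> and \<open>r\<^sup>2\<close> by polynomials of degree \<open>e\<close>
  never increases the weight.\<close>
inductive V :: "nat \<Rightarrow> algfun \<Rightarrow> bool" where
  const: "V 0 (af_const c)"
| x: "V 1 af_x"
| y: "V 1 y"
| s: "V e s"
| r: "V e r"
| mult: "V k a \<Longrightarrow> V l b \<Longrightarrow> V (k + l) (a * b)"
| add: "V k a \<Longrightarrow> V k b \<Longrightarrow> V k (a + b)"
| up: "V k a \<Longrightarrow> k \<le> l \<Longrightarrow> V l a"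

lemma V_mult: "V k a \<Longrightarrow> V l b \<Longrightarrow> k + l \<le> n \<Longrightarrow> V n (a * b)"
  by (rule V.up[OF V.mult])

lemma V_const: "V k (af_const c)" "V k 0" "V k 1"
  using V.up[OF V.const, of k c] V.up[OF V.const, of k 0] V.up[OF V.const, of k 1] by simp_all

lemma V_add: "V k a \<Longrightarrow> V l b \<Longrightarrow> k \<le> n \<Longrightarrow> l \<le> n \<Longrightarrow> V n (a + b)"
  by (intro V.add) (rule V.up, assumption+)+

lemma V_uminus: "V k a \<Longrightarrow> V k (- a)"
  using V_mult[OF V.const[of "- 1"], of k a k] by simp

lemma V_diff: "V k a \<Longrightarrow> V l b \<Longrightarrow> k \<le> n \<Longrightarrow> l \<le> n \<Longrightarrow> V n (a - b)"
  using V_add[OF _ V_uminus, of k a l b n] by simp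

lemma V_power: "V k a \<Longrightarrow> V (n * k) (a ^ n)"
  by (induction n) (auto intro: V_const V.mult)

lemma V_eval:
  assumes "V 1 z" "degree p \<le> k"
  shows "V k (af_eval p z)"
  using assms(2)
proof (induction p arbitrary: k)
  case (pCons c p)
  show ?case
  proof (cases "p = 0")
    case False
    hence k: "k \<ge> 1" "degree p \<le> k - 1" using pCons.prems by auto
    have "V k (z * af_eval p z)" using k by (intro V_mult[OF assms(1) pCons.IH[OF k(2)]]) simp
    thus ?thesis by (auto intro!: V.add V_const)
  qed (simp add: V_const)
qed (simp add: V_const)

lemmas V_eval_y = V_eval[OF V.y]

lemma V_fun_of: "degree p \<le> k \<Longrightarrow> V k (fun_of p)"
  using V_eval[OF V.x] by simp

text \<open>A constant \<open>y\<close> would make \<open>h(x) = h(y)\<close> constant.\<close>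
lemma y_transcendental: "p \<noteq> 0 \<Longrightarrow> af_eval p y \<noteq> 0"
proof
  assume "p \<noteq> 0" "af_eval p y = 0"
  then obtain c where "y = af_const c" using af_eval_eq_0_imp_const by blast
  moreover have "af_eval q (af_const c) = af_const (poly q c)" for q
    by (induction q) simp_all
  ultimately have "fun_of h = fun_of [:poly h c:]" using h_y by (simp add: fun_of_const)
  hence "h = [:poly h c:]" by simp
  thus False using deg_h by (metis degree_pCons_0 less_irrefl)
qed

lemma pderiv_h_nz: "af_eval (pderiv h) y \<noteq> 0"
  using deg_h by (intro y_transcendental) (simp add: pderiv_eq_0_iff)

lemma deriv_y: "af_eval (pderiv h) y * af_deriv y = fun_of (pderiv h)"
  using arg_cong[OF h_y, of af_deriv] by (simp add: af_deriv_af_eval af_deriv_basic)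

lemma deriv_square_root:
  assumes "t\<^sup>2 = a"
  shows "a * af_deriv t = af_const (1/2) * (af_deriv a * t)"
proof -
  have 2: "af_const (1/2) * 2 = 1"
    using af_const_simps(3)[of "1/2" "1/2"] by (simp add: mult_2_right)
  have "af_deriv a = 2 * (t * af_deriv t)"
    using assms af_deriv_basic(2)[of t t] by (simp add: power2_eq_square mult_ac)
  hence "af_const (1/2) * (af_deriv a * t) = (af_const (1/2) * 2) * (t * t * af_deriv t)"
    by (simp add: mult_ac)
  also have "\<dots> = a * af_deriv t" unfolding 2 using assms by (simp add: power2_eq_square)
  finally show ?thesis by (rule sym)
qed

text \<open>A common denominator for the derivatives of \<open>y\<close>, \<open>s\<close> and \<open>r\<close>.\<close>
definition "g = af_eval (pderiv h) y * fun_of \<Delta> * af_eval \<Delta> y"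
abbreviation "w \<equiv> m + 2 * e"

lemma g_nz: "g \<noteq> 0"
  using pderiv_h_nz y_transcendental[OF \<Delta>_nz] \<Delta>_nz by (simp add: g_def)

lemma V_g: "V w g"
  unfolding g_def
  by (rule V.up[OF V.mult[OF V.mult[OF V_eval_y V_fun_of] V_eval_y, OF order.refl order.refl order.refl]])
     (simp add: degree_pderiv)

lemma V_deriv: "V k z \<Longrightarrow> V (k + w) (g * af_deriv z)"
proof (induction rule: V.induct)
  case (const c)
  show ?case by (simp add: V_const)
next
  case x
  show ?case using V.up[OF V_g] by simp
next
  case y
  have "V w (fun_of (pderiv h) * fun_of \<Delta> * af_eval \<Delta> y)"
    by (rule V.up[OF V.mult[OF V.mult[OF V_fun_of V_fun_of] V_eval_y, OF order.refl order.refl order.refl]])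
       (simp add: degree_pderiv)
  moreover have "g * af_deriv y = fun_of (pderiv h) * fun_of \<Delta> * af_eval \<Delta> y"
    using deriv_y by (simp add: g_def mult_ac)
  ultimately show ?case by (auto intro: V.up)
next
  case s
  have "g * af_deriv s = af_eval (pderiv h) y * af_eval \<Delta> y * (fun_of \<Delta> * af_deriv s)"
    by (simp add: g_def mult_ac)
  also have "\<dots> = af_eval (pderiv h) y * af_eval \<Delta> y *
      (af_const (1/2) * (fun_of (pderiv \<Delta>) * s))"
    using deriv_square_root[OF s_sq] by (simp add: af_deriv_basic)
  also have "V (e + w) \<dots>"
    by (rule V.up[OF V.mult[OF V.mult[OF V_eval_y V_eval_y] V.mult[OF V.const V.mult[OF V_fun_of V.s]],
          OF order.refl order.refl order.refl]])
       (simp add: degree_pderiv)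
  finally show ?case .
next
  case r
  have "g * af_deriv r = af_eval (pderiv h) y * fun_of \<Delta> * (af_eval \<Delta> y * af_deriv r)"
    by (simp add: g_def mult_ac)
  also have "\<dots> = (af_eval (pderiv h) y * af_deriv y) * fun_of \<Delta> *
      (af_const (1/2) * (af_eval (pderiv \<Delta>) y * r))"
    using deriv_square_root[OF r_sq] by (simp add: af_deriv_af_eval mult_ac)
  also have "\<dots> = fun_of (pderiv h) * fun_of \<Delta> * (af_const (1/2) * (af_eval (pderiv \<Delta>) y * r))"
    by (simp only: deriv_y)
  also have "V (e + w) \<dots>"
    by (rule V.up[OF V.mult[OF V.mult[OF V_fun_of V_fun_of] V.mult[OF V.const V.mult[OF V_eval_y V.r]],
          OF order.refl order.refl order.refl]])
       (simp add: degree_pderiv)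
  finally show ?case .
next
  case (mult k a l b)
  have "V (k + l + w) (a * (g * af_deriv b) + (g * af_deriv a) * b)"
    using mult by (intro V.add; elim V_mult) (assumption | simp)+
  thus ?case by (simp add: af_deriv_basic algebra_simps)
next
  case (add k a b)
  thus ?case using V.add by (simp add: af_deriv_basic distrib_left)
next
  case (up k a l)
  thus ?case by (intro V.up[OF up.IH]) simp
qed

text \<open>The quotients of height at most \<open>M\<close>, measured by the weights of numerator and denominator.\<close>
definition Q :: "nat \<Rightarrow> algfun set" where
  "Q M = {a / b | a b. V M a \<and> V M b \<and> b \<noteq> 0}"

lemma Q_I: "V M a \<Longrightarrow> V M b \<Longrightarrow> b \<noteq> 0 \<Longrightarrow> a / b \<in> Q M"
  unfolding Q_def by blast

lemma Q_of_V: "V M a \<Longrightarrow> a \<in> Q M"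
  using Q_I[of M a 1] V_const by simp

lemma Q_mono: "M \<le> N \<Longrightarrow> Q M \<subseteq> Q N"
  unfolding Q_def using V.up by blast

lemma Q_E:
  assumes "a \<in> Q M" obtains p q where "a = p / q" "V M p" "V M q" "q \<noteq> 0"
  using assms unfolding Q_def by blast

lemma Q_mult:
  assumes "a \<in> Q M" "b \<in> Q N" shows "a * b \<in> Q (M + N)"
proof -
  obtain p q where 1: "a = p / q" "V M p" "V M q" "q \<noteq> 0" using assms(1) by (rule Q_E)
  obtain p' q' where 2: "b = p' / q'" "V N p'" "V N q'" "q' \<noteq> 0" using assms(2) by (rule Q_E)
  have "(p * p') / (q * q') \<in> Q (M + N)" using 1 2 by (intro Q_I V.mult) simp_all
  thus ?thesis using 1 2 by simp
qed

lemma Q_add: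
  assumes "a \<in> Q M" "b \<in> Q N" shows "a + b \<in> Q (M + N)"
proof -
  obtain p q where 1: "a = p / q" "V M p" "V M q" "q \<noteq> 0" using assms(1) by (rule Q_E)
  obtain p' q' where 2: "b = p' / q'" "V N p'" "V N q'" "q' \<noteq> 0" using assms(2) by (rule Q_E)
  have "V (M + N) (p * q' + q * p')" using 1 2 by (intro V.add V.mult)
  hence "(p * q' + q * p') / (q * q') \<in> Q (M + N)" using 1 2 by (intro Q_I V.mult) simp_all
  thus ?thesis using 1 2 by (simp add: add_frac_eq mult_ac)
qed

lemma Q_inverse:
  assumes "a \<in> Q M" shows "inverse a \<in> Q M"
proof -
  obtain p q where 1: "a = p / q" "V M p" "V M q" "q \<noteq> 0" using assms(1) by (rule Q_E)
  show ?thesis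
  proof (cases "p = 0")
    case True thus ?thesis using 1 Q_of_V V_const by simp
  next
    case False thus ?thesis using 1 Q_I[of M q p] by simp
  qed
qed

lemma Q_deriv:
  assumes "a \<in> Q M" shows "af_deriv a \<in> Q (2 * M + w)"
proof -
  obtain p q where 1: "a = p / q" "V M p" "V M q" "q \<noteq> 0" using assms(1) by (rule Q_E)
  have "V (2 * M + w) ((g * af_deriv p) * q - p * (g * af_deriv q))"
    using V_mult[OF V_deriv[OF 1(2)] 1(3), of "2 * M + w"] V_mult[OF 1(2) V_deriv[OF 1(3)], of "2 * M + w"]
    by (intro V_diff) auto
  moreover have "V (2 * M + w) (g * (q * q))"
    by (rule V_mult[OF V_g V.mult[OF 1(3) 1(3)]]) simp
  ultimately have "((g * af_deriv p) * q - p * (g * af_deriv q)) / (g * (q * q)) \<in> Q (2 * M + w)"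
    using g_nz 1(4) by (intro Q_I) simp_all
  moreover have "((g * af_deriv p) * q - p * (g * af_deriv q)) = g * (af_deriv p * q - p * af_deriv q)"
    by (simp add: algebra_simps)
  hence "((g * af_deriv p) * q - p * (g * af_deriv q)) / (g * (q * q)) = af_deriv a"
    using g_nz 1 by (simp add: af_deriv_divide power2_eq_square)
  ultimately show ?thesis by simp
qed

lemma complexity_filtration_Q:
  assumes "w \<le> M"
  shows "complexity_filtration (\<lambda>k. Q (4 ^ k * M))"
proof
  show "Q (4 ^ k * M) \<subseteq> Q (4 ^ l * M)" if "k \<le> l" for k l
    by (intro Q_mono mult_right_mono power_increasing that) simp_all
next
  fix c k show "af_const c \<in> Q (4 ^ k * M)" by (intro Q_of_V V_const)
next
  fix a b k assume ab: "a \<in> Q (4 ^ k * M)" "b \<in> Q (4 ^ k * M)"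
  have *: "4 ^ k * M + 4 ^ k * M \<le> 4 ^ Suc k * M" unfolding power_Suc mult.assoc by linarith
  show "a * b \<in> Q (4 ^ Suc k * M)" "a + b \<in> Q (4 ^ Suc k * M)"
    using Q_mult[OF ab] Q_add[OF ab] Q_mono[OF *] by blast+
next
  fix a k assume a: "a \<in> Q (4 ^ k * M)"
  show "inverse a \<in> Q (4 ^ k * M)" using a by (rule Q_inverse)
  have "M * 1 \<le> M * 4 ^ k" by (intro mult_le_mono2) simp
  hence "w \<le> 4 ^ k * M" using assms by (simp only: mult_1_right mult.commute[of M])
  hence "2 * (4 ^ k * M) + w \<le> 4 ^ Suc k * M" unfolding power_Suc mult.assoc by linarith
  thus "af_deriv a \<in> Q (4 ^ Suc k * M)" using Q_deriv[OF a] Q_mono by blast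
qed

text \<open>The exponent enters the logarithmic derivative only as a constant factor, so it does not
  affect the weight.\<close>
lemma log_deriv_in_Q:
  assumes "a \<in> Q c" "b \<in> Q c" "a \<noteq> 0" "b \<noteq> 0"
  shows "af_deriv (a * b ^ n) / (a * b ^ n) \<in> Q (6 * c + 2 * w)"
proof -
  have 1: "af_deriv a / a \<in> Q (3 * c + w)" if "a \<in> Q c" for a
    using Q_mult[OF Q_deriv[OF that] Q_inverse[OF that]] by (simp add: divide_inverse algebra_simps)
  have "af_const (of_nat n) * (af_deriv b / b) \<in> Q (0 + (3 * c + w))"
    by (intro Q_mult Q_of_V V_const 1 assms)
  from Q_add[OF 1[OF assms(1)] this]
  have "af_deriv a / a + af_const (of_nat n) * (af_deriv b / b) \<in> Q (6 * c + 2 * w)"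
    by (simp add: algebra_simps)
  moreover have "af_deriv (a * b ^ n) / (a * b ^ n) = af_deriv a / a + of_nat n * (af_deriv b / b)"
  proof (cases n)
    case (Suc k)
    have "b ^ (n - 1) * b = b ^ n" using Suc by simp
    hence "af_deriv (b ^ n) / b ^ n = of_nat n * (af_deriv b / b)"
      using assms(4) by (simp add: af_deriv_power divide_simps mult_ac)
    moreover have "af_deriv (a * b ^ n) / (a * b ^ n) = af_deriv a / a + af_deriv (b ^ n) / b ^ n"
      using assms(3,4) by (simp add: af_deriv_basic add_divide_distrib)
    ultimately show ?thesis by simp
  qed simp
  moreover have "af_const (of_nat n) = of_nat n" by (induction n) simp_all
  ultimately show ?thesis by simp
qed

end

section \<open>Total degrees of factors\<close>

definition total_degree_le :: "'a :: comm_ring_1 poly poly \<Rightarrow> nat \<Rightarrow> bool" where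
  "total_degree_le P k \<longleftrightarrow> (\<forall>i. coeff P i \<noteq> 0 \<longrightarrow> degree (coeff P i) + i \<le> k)"

lemma last_top_coeff:
  assumes "P \<noteq> 0"
  obtains a i where "total_degree_le P a" "coeff P i \<noteq> 0" "degree (coeff P i) + i = a"
    "\<And>j. j > i \<Longrightarrow> coeff P j \<noteq> 0 \<Longrightarrow> degree (coeff P j) + j < a"
proof -
  define S where "S = {i. coeff P i \<noteq> 0}"
  define t where "t = (\<lambda>i. degree (coeff P i) + i)"
  have "S \<subseteq> {..degree P}" "degree P \<in> S" using assms le_degree[of P] by (auto simp: S_def)
  hence S: "finite S" "S \<noteq> {}" using finite_subset[of S "{..degree P}"] by auto
  define a where "a = Max (t ` S)"
  have a: "a \<in> t ` S" "\<And>i. i \<in> S \<Longrightarrow> t i \<le> a" using S by (auto simp: a_def)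
  define T where "T = {i\<in>S. t i = a}"
  have T: "finite T" "T \<noteq> {}" using S a(1) by (auto simp: T_def)
  have "Max T \<in> T" using T by simp
  show ?thesis
  proof (rule that[of a "Max T"])
    show "total_degree_le P a" using a(2) by (simp add: total_degree_le_def S_def t_def)
    show "coeff P (Max T) \<noteq> 0" "degree (coeff P (Max T)) + Max T = a"
      using \<open>Max T \<in> T\<close> by (simp_all add: T_def S_def t_def)
  next
    fix j assume j: "j > Max T" "coeff P j \<noteq> 0"
    hence "j \<notin> T" using Max_ge[OF T(1)] by (meson leD)
    thus "degree (coeff P j) + j < a" using j(2) a(2)[of j] by (auto simp: T_def S_def t_def)
  qed
qed

text \<open>Total degree is additive. The product of the two coefficients at the last indices where
  the total degree is attained is the only contribution of maximal degree to its
  coefficient in the product, so it cannot cancel.\<close>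
lemma total_degree_factors:
  fixes P R :: "'a :: idom poly poly"
  assumes PR: "total_degree_le (P * R) k" and nz: "P \<noteq> 0" "R \<noteq> 0"
  obtains a b where "total_degree_le P a" "total_degree_le R b" "a + b \<le> k"
proof -
  obtain a i where P: "total_degree_le P a" "coeff P i \<noteq> 0" "degree (coeff P i) + i = a"
    "\<And>j. j > i \<Longrightarrow> coeff P j \<noteq> 0 \<Longrightarrow> degree (coeff P j) + j < a"
    using last_top_coeff[OF nz(1)] by blast
  obtain b j where R: "total_degree_le R b" "coeff R j \<noteq> 0" "degree (coeff R j) + j = b"
    "\<And>l. l > j \<Longrightarrow> coeff R l \<noteq> 0 \<Longrightarrow> degree (coeff R l) + l < b"
    using last_top_coeff[OF nz(2)] by blast
  define N where "N = degree (coeff P i) + degree (coeff R j)"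
  have "coeff (coeff P l * coeff R (i + j - l)) N = 0" if "l \<le> i + j" "l \<noteq> i" for l
  proof (cases "coeff P l = 0 \<or> coeff R (i + j - l) = 0")
    case False
    hence le: "degree (coeff P l) + l \<le> a" "degree (coeff R (i + j - l)) + (i + j - l) \<le> b"
      using P(1) R(1) by (auto simp: total_degree_le_def)
    have "degree (coeff P l) + degree (coeff R (i + j - l)) < N"
    proof (cases "l > i")
      case True
      thus ?thesis using P(3) P(4)[of l] R(3) le False that unfolding N_def by linarith
    next
      case l: False
      hence "i + j - l > j" using that by simp
      thus ?thesis using R(3) R(4)[of "i + j - l"] P(3) le False that unfolding N_def by linarith
    qed
    thus ?thesis by (intro coeff_eq_0 le_less_trans[OF degree_mult_le])
  qed auto
  hence "coeff (coeff (P * R) (i + j)) N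
      = (\<Sum>l\<in>{i}. coeff (coeff P l * coeff R (i + j - l)) N)"
    unfolding coeff_mult[of P] coeff_sum by (intro sum.mono_neutral_right) auto
  also have "\<dots> = lead_coeff (coeff P i) * lead_coeff (coeff R j)"
    by (simp add: N_def coeff_mult_degree_sum)
  finally have nzN: "coeff (coeff (P * R) (i + j)) N \<noteq> 0" using P(2) R(2) by simp
  hence "N \<le> degree (coeff (P * R) (i + j))" "coeff (P * R) (i + j) \<noteq> 0"
    by (auto intro: le_degree)
  hence "N + (i + j) \<le> k" using PR by (force simp: total_degree_le_def)
  hence "a + b \<le> k" using P(3) R(3) by (simp add: N_def)
  thus ?thesis using that P(1) R(1) by blast
qed

interpretation af: vector_space "\<lambda>c z. af_const c * z"
  by unfold_locales (simp_all add: algebra_simps)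

lemma mult_span:
  assumes "\<And>b. b \<in> B \<Longrightarrow> c * b \<in> af.span B'" "z \<in> af.span B"
  shows "c * z \<in> af.span B'"
  using assms(2)
proof (induction rule: af.span_induct_alt)
  case base
  show ?case by (simp add: af.span_zero)
next
  case (step a b z)
  have "af_const a * (c * b) + c * z \<in> af.span B'"
    by (intro af.span_add af.span_scale assms(1) step)
  thus ?case by (simp add: algebra_simps)
qed

lemma relation_if_many:
  assumes "finite T" "finite I" "card T < card I" "\<And>i. i \<in> I \<Longrightarrow> b i \<in> af.span T"
  obtains c where "(\<Sum>i\<in>I. af_const (c i) * b i) = 0" "\<exists>i\<in>I. c i \<noteq> 0"
proof (cases "inj_on b I")
  case False
  then obtain i j where ij: "i \<in> I" "j \<in> I" "i \<noteq> j" "b i = b j" by (auto simp: inj_on_def)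
  define c where "c = (\<lambda>k. if k = i then 1 else if k = j then - 1 else (0 :: complex))"
  have "(\<Sum>k\<in>I. af_const (c k) * b k) = (\<Sum>k\<in>{i, j}. af_const (c k) * b k)"
    using ij assms(2) by (intro sum.mono_neutral_right) (auto simp: c_def)
  also have "\<dots> = 0" using ij by (simp add: c_def)
  finally show ?thesis using ij(1) by (intro that[of c] bexI[of _ i]) (simp_all add: c_def)
next
  case True
  have "af.dependent (b ` I)"
  proof (rule ccontr)
    assume "af.independent (b ` I)"
    hence "card (b ` I) \<le> card T"
      using af.independent_span_bound[OF assms(1)] assms(4) by blast
    thus False using assms(3) card_image[OF True] by simp
  qed
  then obtain u where u: "\<exists>v\<in>b ` I. u v \<noteq> 0" "(\<Sum>v\<in>b ` I. af_const (u v) * v) = 0"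
    using af.dependent_finite[of "b ` I"] assms(2) by auto
  show ?thesis
    using that[of "u \<circ> b"] u by (auto simp: sum.reindex[OF True])
qed

context conjugate_point
begin

text \<open>The primitive polynomial of least degree that vanishes at \<open>y\<close> divides \<open>h(T) - h(x)\<close> by
  Gauss's lemma. The latter is monic up to a constant and its total degree equals its
  degree in \<open>T\<close>, and both properties pass to factors. They say that \<open>y\<^sup>d\<close> can be rewritten
  in lower powers of \<open>y\<close> without increasing the weight.\<close>
lemma minimal_polynomial:
  obtains F d where "degree F = d" "d > 0" "lead_coeff F = 1" "bieval F y = 0"
    "total_degree_le F d" "\<And>P. degree P < d \<Longrightarrow> bieval P y = 0 \<Longrightarrow> P = 0"
proof -
  define d where "d = (LEAST d. \<exists>P. P \<noteq> 0 \<and> bieval P y = 0 \<and> degree P = d)"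
  have ex: "\<exists>d P. P \<noteq> 0 \<and> bieval P y = 0 \<and> degree P = d"
    using algebraic_over_polys by blast
  obtain P where P: "P \<noteq> 0" "bieval P y = 0" "degree P = d"
    using LeastI_ex[OF ex] unfolding d_def by blast
  have min: "R = 0" if "degree R < d" "bieval R y = 0" for R
    using that not_less_Least[of "degree R" "\<lambda>d. \<exists>P. P \<noteq> 0 \<and> bieval P y = 0 \<and> degree P = d"]
    unfolding d_def by blast
  define F where "F = primitive_part P"
  have "P = smult (content P) F" by (simp add: F_def)
  hence "fun_of (content P) * bieval F y = 0" using P(2) by (metis bieval_simps(7))
  hence F: "bieval F y = 0" "F \<noteq> 0" "degree F = d" "content F = 1"
    using P by (auto simp: F_def)
  define H where "H = map_poly (\<lambda>c. [:c:]) h - [:h:]"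
  have "bieval (map_poly (\<lambda>c. [:c:]) p) y = af_eval p y" for p
    by (induction p) (simp_all add: map_poly_pCons fun_of_const)
  hence "bieval H y = 0" using h_y by (simp add: H_def)
  have coH: "coeff H i = [:coeff h i:] - (if i = 0 then h else 0)" for i
    by (simp add: H_def coeff_map_poly coeff_pCons split: nat.split)
  obtain a q R where aq: "a \<noteq> 0" "smult a H = F * q + R" "R = 0 \<or> degree R < d"
    using pseudo_mod[OF F(2), of H] F(3) by blast
  have "bieval R y = 0"
    using arg_cong[OF aq(2), of "\<lambda>P. bieval P y"] \<open>bieval H y = 0\<close> F(1) by simp
  hence "smult a H = F * q" using aq min by auto
  hence "fract_poly F dvd smult (to_fract a) (fract_poly H)"
    by (metis fract_poly_smult fract_poly_mult dvd_triv_left)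
  hence "F dvd H" using aq(1) F(4) by (intro fract_poly_dvdD) (auto simp: dvd_smult_iff)
  then obtain G where G: "H = F * G" by blast
  have degH: "degree H = m"
  proof (rule antisym)
    show "degree H \<le> m" by (intro degree_le) (auto simp: coH coeff_eq_0)
    show "m \<le> degree H" using deg_h by (intro le_degree) (auto simp: coH)
  qed
  have H0: "H \<noteq> 0" using degH deg_h by auto
  have G0: "G \<noteq> 0" using H0 G by auto
  have dG: "d + degree G = m" using degH G F G0 by (simp add: degree_mult_eq)
  have "lead_coeff F * lead_coeff G = [:lead_coeff h:]"
    using coH[of m] degH deg_h by (simp add: lead_coeff_mult[symmetric] G[symmetric])
  moreover have "degree (lead_coeff F * lead_coeff G) = degree (lead_coeff F) + degree (lead_coeff G)"
    using F(2) G0 by (intro degree_mult_eq) auto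
  ultimately have "degree (lead_coeff F) = 0" by simp
  then obtain c where c: "lead_coeff F = [:c:]" by (meson degree_eq_zeroE)
  hence c0: "c \<noteq> 0" using F(2) by auto
  define F' where "F' = smult [:1 / c:] F"
  define G' where "G' = smult [:c:] G"
  have F'0: "F' \<noteq> 0" "G' \<noteq> 0" and degF': "degree F' = d" "degree G' = degree G"
    using F G0 c0 by (simp_all add: F'_def G'_def)
  have "H = F' * G'" using G c0 by (simp add: F'_def G'_def one_pCons[symmetric])
  moreover have "total_degree_le H m"
    unfolding total_degree_le_def
  proof (intro allI impI)
    fix i assume i: "coeff H i \<noteq> 0"
    show "degree (coeff H i) + i \<le> m"
    proof (cases "i = 0")
      case True
      thus ?thesis using degree_diff_le[of "[:coeff h 0:]" m h] by (simp add: coH)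
    next
      case False
      thus ?thesis using i by (auto simp: coH intro!: le_degree)
    qed
  qed
  ultimately obtain a b where ab: "total_degree_le F' a" "total_degree_le G' b" "a + b \<le> m"
    using total_degree_factors F'0 by metis
  have "degree G \<le> b"
    using ab(2) F'0(2) degF' leading_coeff_neq_0[of G'] unfolding total_degree_le_def
    by (metis add_leE)
  hence "a \<le> d" using ab(3) dG by linarith
  hence td: "total_degree_le F' d" using ab(1) unfolding total_degree_le_def by (meson order.trans)
  have "d \<noteq> 0"
  proof
    assume "d = 0"
    then obtain q where "F = [:q:]" using F(3) by (meson degree_eq_zeroE)
    thus False using F(1,2) by simp
  qed
  thus ?thesis
    using that[of F' d] td degF' min F(1) c c0 F(3)
    by (simp add: F'_def one_pCons[symmetric] coeff_smult)
qed

context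
  fixes F :: "complex poly poly" and d :: nat
  assumes F: "degree F = d" "d > 0" "lead_coeff F = 1" "bieval F y = 0" "total_degree_le F d"
begin

definition mon :: "nat \<times> nat \<times> nat \<times> nat \<Rightarrow> algfun" where
  "mon = (\<lambda>(i, j, a, b). af_x ^ i * y ^ j * s ^ a * r ^ b)"

text \<open>The exponents that remain after the reductions of \<open>y\<^sup>d\<close>, \<open>s\<^sup>2\<close> and \<open>r\<^sup>2\<close>; the weight of \<open>s\<close> and
  \<open>r\<close> is not counted, which only enlarges the span \<open>U k\<close>.\<close>
definition reduced :: "nat \<Rightarrow> (nat \<times> nat \<times> nat \<times> nat) set" where
  "reduced k = {(i, j, a, b). i + j \<le> k \<and> j < d \<and> a < 2 \<and> b < 2}"

definition U :: "nat \<Rightarrow> algfun set" where "U k = af.span (mon ` reduced k)"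

lemma finite_reduced: "finite (mon ` reduced k)" and card_reduced: "card (mon ` reduced k) \<le> 4 * d * (k + 1)"
proof -
  have sub: "reduced k \<subseteq> {..k} \<times> {..<d} \<times> {..<2} \<times> {..<2}" by (auto simp: reduced_def)
  hence fin: "finite (reduced k)" by (rule finite_subset) auto
  thus "finite (mon ` reduced k)" by simp
  have "card (reduced k) \<le> 4 * d * (k + 1)"
    using card_mono[OF _ sub] by (simp add: card_cartesian_product algebra_simps)
  thus "card (mon ` reduced k) \<le> 4 * d * (k + 1)" using card_image_le[OF fin, of mon] by linarith
qed

lemma U_mon: "i + j \<le> k \<Longrightarrow> j < d \<Longrightarrow> a < 2 \<Longrightarrow> b < 2 \<Longrightarrow> af_x ^ i * y ^ j * s ^ a * r ^ b \<in> U k"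
  unfolding U_def
  by (intro af.span_base image_eqI[of _ mon "(i, j, a, b)"]) (simp_all add: mon_def reduced_def)

lemma U_up: "z \<in> U k \<Longrightarrow> k \<le> l \<Longrightarrow> z \<in> U l"
  unfolding U_def by (erule set_mp[OF af.span_mono[OF image_mono], rotated]) (auto simp: reduced_def)

lemma U_closed: "z \<in> U k \<Longrightarrow> z' \<in> U k \<Longrightarrow> z + z' \<in> U k" "z \<in> U k \<Longrightarrow> af_const c * z \<in> U k" "0 \<in> U k"
  unfolding U_def by (simp_all add: af.span_add af.span_scale af.span_zero)

lemma U_mult_mon:
  assumes "z \<in> U k"
    and "\<And>i j a b. i + j \<le> k \<Longrightarrow> j < d \<Longrightarrow> a < 2 \<Longrightarrow> b < 2 \<Longrightarrow> c * (af_x ^ i * y ^ j * s ^ a * r ^ b) \<in> U l"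
  shows "c * z \<in> U l"
  unfolding U_def
proof (rule mult_span[OF _ assms(1)[unfolded U_def]], fold U_def)
  fix v assume "v \<in> mon ` reduced k"
  then obtain i j a b where "v = af_x ^ i * y ^ j * s ^ a * r ^ b"
    "i + j \<le> k" "j < d" "a < 2" "b < 2"
    by (auto simp: mon_def reduced_def)
  thus "c * v \<in> U l" using assms(2)[of i j a b] by simp
qed

lemma U_x:
  assumes "z \<in> U k" shows "af_x * z \<in> U (Suc k)"
  using assms
proof (rule U_mult_mon)
  fix i j a b :: nat assume "i + j \<le> k" "j < d" "a < 2" "b < 2"
  thus "af_x * (af_x ^ i * y ^ j * s ^ a * r ^ b) \<in> U (Suc k)"
    using U_mon[of "Suc i" j "Suc k" a b] by (simp add: mult.assoc)
qed

text \<open>Stated for an arbitrary \<open>t\<close> because it is needed both for \<open>x\<close> and, once multiplication by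
  \<open>y\<close> has been treated, for \<open>y\<close>.\<close>
lemma U_eval:
  assumes "\<And>k z. z \<in> U k \<Longrightarrow> t * z \<in> U (Suc k)" "z \<in> U k" "degree p \<le> l"
  shows "af_eval p t * z \<in> U (k + l)"
  using assms(3)
proof (induction p arbitrary: l)
  case (pCons c p)
  have 1: "af_const c * z \<in> U (k + l)" using U_up[OF U_closed(2)[OF assms(2)]] by simp
  show ?case
  proof (cases "p = 0")
    case False
    hence l: "degree p \<le> l - 1" "l > 0" using pCons.prems by auto
    have "t * (af_eval p t * z) \<in> U (k + l)"
      using assms(1)[OF pCons.IH[OF l(1)]] l(2) by simp
    from U_closed(1)[OF 1 this] show ?thesis by (simp add: algebra_simps)
  qed (use 1 in simp)
qed (simp add: U_closed)

lemma U_fun_of: "z \<in> U k \<Longrightarrow> degree p \<le> l \<Longrightarrow> fun_of p * z \<in> U (k + l)"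
  using U_eval[OF U_x] by simp

lemma y_power_d: "y ^ d = (\<Sum>i<d. fun_of (- coeff F i) * y ^ i)"
proof -
  have "0 = (\<Sum>i\<le>d. fun_of (coeff F i) * y ^ i)"
    using F(4) bieval_altdef[of F d y] F(1) by simp
  also have "\<dots> = (\<Sum>i<d. fun_of (coeff F i) * y ^ i) + y ^ d"
    using F(1,3) by (simp add: lessThan_Suc_atMost[symmetric])
  finally have "y ^ d = - (\<Sum>i<d. fun_of (coeff F i) * y ^ i)"
    by (metis add.commute eq_neg_iff_add_eq_0)
  thus ?thesis by (simp add: sum_negf)
qed

lemma U_y:
  assumes "z \<in> U k" shows "y * z \<in> U (Suc k)"
  using assms
proof (rule U_mult_mon)
  fix i j a b :: nat assume ij: "i + j \<le> k" "j < d" "a < 2" "b < 2"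
  show "y * (af_x ^ i * y ^ j * s ^ a * r ^ b) \<in> U (Suc k)"
  proof (cases "Suc j < d")
    case True
    thus ?thesis using U_mon[of i "Suc j" "Suc k" a b] ij by (simp add: mult_ac)
  next
    case False
    hence d: "d = Suc j" using ij by simp
    have "y * (af_x ^ i * y ^ j * s ^ a * r ^ b) = y ^ d * (af_x ^ i * s ^ a * r ^ b)"
      by (simp add: d mult_ac)
    also have "\<dots> = (\<Sum>l<d. fun_of (- coeff F l) * (af_x ^ i * y ^ l * s ^ a * r ^ b))"
      unfolding y_power_d sum_distrib_right by (simp add: mult_ac)
    also have "\<dots> \<in> U (Suc k)"
      unfolding U_def
    proof (rule af.span_sum, fold U_def)
      fix l assume l: "l \<in> {..<d}"
      show "fun_of (- coeff F l) * (af_x ^ i * y ^ l * s ^ a * r ^ b) \<in> U (Suc k)"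
      proof (cases "coeff F l = 0")
        case False
        hence "degree (- coeff F l) \<le> d - l" using F(5) unfolding total_degree_le_def by force
        moreover have "af_x ^ i * y ^ l * s ^ a * r ^ b \<in> U (i + l)"
          using l ij by (intro U_mon) auto
        ultimately have "fun_of (- coeff F l) * (af_x ^ i * y ^ l * s ^ a * r ^ b) \<in> U (i + l + (d - l))"
          by (intro U_fun_of)
        thus ?thesis by (rule U_up) (use l d ij in simp)
      qed (simp add: U_closed)
    qed
    finally show ?thesis .
  qed
qed

lemma U_s:
  assumes "z \<in> U k" shows "s * z \<in> U (k + e)"
  using assms
proof (rule U_mult_mon)
  fix i j a b :: nat assume ij: "i + j \<le> k" "j < d" "a < 2" "b < 2"
  show "s * (af_x ^ i * y ^ j * s ^ a * r ^ b) \<in> U (k + e)"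
  proof (cases "a = 0")
    case True
    thus ?thesis using U_mon[of i j "k + e" 1 b] ij by (simp add: mult_ac)
  next
    case False
    hence "a = 1" using ij by simp
    moreover have "fun_of \<Delta> * (af_x ^ i * y ^ j * s ^ 0 * r ^ b) \<in> U (k + e)"
      using ij by (intro U_fun_of U_mon) simp_all
    ultimately show ?thesis by (simp add: s_sq[symmetric] power2_eq_square mult_ac)
  qed
qed

lemma U_r:
  assumes "z \<in> U k" shows "r * z \<in> U (k + e)"
  using assms
proof (rule U_mult_mon)
  fix i j a b :: nat assume ij: "i + j \<le> k" "j < d" "a < 2" "b < 2"
  show "r * (af_x ^ i * y ^ j * s ^ a * r ^ b) \<in> U (k + e)"
  proof (cases "b = 0")
    case True
    thus ?thesis using U_mon[of i j "k + e" a 1] ij by (simp add: mult_ac)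
  next
    case False
    hence "b = 1" using ij by simp
    moreover have "af_eval \<Delta> y * (af_x ^ i * y ^ j * s ^ a * r ^ 0) \<in> U (k + e)"
      using ij by (intro U_eval[OF U_y] U_mon) simp_all
    ultimately show ?thesis by (simp add: r_sq[symmetric] power2_eq_square mult_ac)
  qed
qed

text \<open>Products of reduced monomials are not reduced, but every generator maps \<open>U l\<close> into the
  appropriate \<open>U (l + k)\<close>, and this property is stable under sums and products.\<close>
lemma V_acts_on_U: "V k z \<Longrightarrow> u \<in> U l \<Longrightarrow> z * u \<in> U (l + k)"
proof (induction arbitrary: u l rule: V.induct)
  case (mult k a l' b)
  show ?case using mult.IH(1)[OF mult.IH(2)[OF mult.prems]] by (simp add: mult.assoc add_ac)
next
  case (up k a l')
  show ?case using up.IH[OF up.prems] up.hyps by (auto intro: U_up)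
qed (auto simp: distrib_right intro: U_closed U_x U_y U_s U_r)

lemma V_subset_U: "V k z \<Longrightarrow> z \<in> U k"
  using V_acts_on_U[of k z 1 0] U_mon[of 0 0 0 0 0] F(2) by simp

end

text \<open>The dimension of the elements of weight at most \<open>k\<close> grows like \<open>4 d k\<close>, where \<open>d\<close> is the
  degree of \<open>y\<close> over \<open>\<complex>(x)\<close>: the monomials with \<open>j < d\<close> and \<open>a, b < 2\<close> suffice.\<close>
theorem weight_space_bound:
  obtains d where "d > 0" "\<And>P. degree P < d \<Longrightarrow> bieval P y = 0 \<Longrightarrow> P = 0"
    "\<And>k. \<exists>T. finite T \<and> card T \<le> 4 * d * (k + 1) \<and> (\<forall>z. V k z \<longrightarrow> z \<in> af.span T)"
proof -
  obtain F d where F: "degree F = d" "d > 0" "lead_coeff F = 1" "bieval F y = 0"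
    "total_degree_le F d" and min: "\<And>P. degree P < d \<Longrightarrow> bieval P y = 0 \<Longrightarrow> P = 0"
    using minimal_polynomial by blast
  show ?thesis
  proof (rule that[OF F(2) min])
    fix k
    show "\<exists>T. finite T \<and> card T \<le> 4 * d * (k + 1) \<and> (\<forall>z. V k z \<longrightarrow> z \<in> af.span T)"
      using finite_reduced[OF F] card_reduced[OF F] V_subset_U[OF F, unfolded U_def[OF F]]
      by blast
  qed
qed

end

section \<open>Valuations of recurrence sequences\<close>

locale poly_valuation =
  fixes v :: "complex poly \<Rightarrow> int"
  assumes v_mult: "p \<noteq> 0 \<Longrightarrow> q \<noteq> 0 \<Longrightarrow> v (p * q) = v p + v q"
    and v_add: "p \<noteq> 0 \<Longrightarrow> q \<noteq> 0 \<Longrightarrow> p + q \<noteq> 0 \<Longrightarrow> min (v p) (v q) \<le> v (p + q)"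
    and v_const: "c \<noteq> 0 \<Longrightarrow> v [:c:] = 0"
begin

lemma v_smult: "c \<noteq> 0 \<Longrightarrow> p \<noteq> 0 \<Longrightarrow> v (smult c p) = v p"
  using v_mult[of "[:c:]" p] v_const by simp

lemma v_uminus: "p \<noteq> 0 \<Longrightarrow> v (- p) = v p"
  using v_smult[of "- 1" p] by simp

lemma v_power: "p \<noteq> 0 \<Longrightarrow> v (p ^ n) = int n * v p"
proof (induction n)
  case 0
  thus ?case using v_const[of 1] by (simp add: one_pCons)
qed (simp add: v_mult algebra_simps)

lemma v_add_less:
  assumes "p \<noteq> 0" "q \<noteq> 0" "v p < v q"
  shows "p + q \<noteq> 0" "v (p + q) = v p"
proof -
  show nz: "p + q \<noteq> 0"
  proof
    assume "p + q = 0"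
    hence "p = - q" by (simp add: eq_neg_iff_add_eq_0)
    thus False using v_uminus[OF assms(2)] assms(3) by simp
  qed
  have "min (v (p + q)) (v (- q)) \<le> v p"
    using v_add[of "p + q" "- q"] nz assms by simp
  thus "v (p + q) = v p" using v_add[OF assms(1,2) nz] assms(3) v_uminus[OF assms(2)] by linarith
qed

text \<open>Terms of pairwise different valuations cannot cancel.\<close>
lemma v_sum_distinct:
  assumes "finite I" "I \<noteq> {}" "\<And>i. i \<in> I \<Longrightarrow> f i \<noteq> 0" "inj_on (\<lambda>i. v (f i)) I"
  shows "sum f I \<noteq> 0 \<and> v (sum f I) \<in> (\<lambda>i. v (f i)) ` I"
  using assms
proof (induction I rule: finite_ne_induct)
  case (insert i I)
  hence IH: "sum f I \<noteq> 0" "v (sum f I) \<in> (\<lambda>i. v (f i)) ` I" and i: "f i \<noteq> 0"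
    by (auto simp: inj_on_def)
  have "v (f i) \<noteq> v (sum f I)" using IH(2) insert by (auto simp: inj_on_def)
  then consider "v (f i) < v (sum f I)" | "v (sum f I) < v (f i)" by linarith
  thus ?case
  proof cases
    case 1
    thus ?thesis using v_add_less[OF i IH(1)] insert by simp
  next
    case 2
    thus ?thesis using v_add_less[OF IH(1) i] IH(2) insert by (simp add: add.commute)
  qed
qed simp

lemma v_independent:
  assumes "finite I" "\<And>i. i \<in> I \<Longrightarrow> f i \<noteq> 0" "inj_on (\<lambda>i. v (f i)) I"
    and "(\<Sum>i\<in>I. smult (c i) (f i)) = 0" "i \<in> I"
  shows "c i = 0"
proof (rule ccontr)
  assume ci: "c i \<noteq> 0"
  define J where "J = {i\<in>I. c i \<noteq> 0}"
  have "(\<Sum>i\<in>J. smult (c i) (f i)) = (\<Sum>i\<in>I. smult (c i) (f i))"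
    using assms(1) by (intro sum.mono_neutral_left) (auto simp: J_def)
  moreover have "inj_on (\<lambda>i. v (smult (c i) (f i))) J"
    using assms(2,3) v_smult by (simp add: inj_on_def J_def)
  ultimately show False
    using v_sum_distinct[of J "\<lambda>i. smult (c i) (f i)"] assms ci by (auto simp: J_def)
qed

definition v_ge :: "int \<Rightarrow> complex poly \<Rightarrow> bool" where
  "v_ge k p \<longleftrightarrow> p = 0 \<or> k \<le> v p"

lemma v_ge_add: "v_ge k p \<Longrightarrow> v_ge k q \<Longrightarrow> v_ge k (p + q)"
  using v_add[of p q] by (cases "p = 0 \<or> q = 0 \<or> p + q = 0") (auto simp: v_ge_def)

lemma v_ge_uminus: "v_ge k p \<Longrightarrow> v_ge k (- p)"
  by (cases "p = 0") (auto simp: v_ge_def v_uminus)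

end

text \<open>The conserved quantity \<open>u\<^sub>n u\<^sub>n\<^sub>+\<^sub>1 A\<^sub>1 - u\<^sub>n\<^sub>+\<^sub>1\<^sup>2 + u\<^sub>n\<^sup>2 A\<^sub>0\<close> of the recurrence.\<close>
definition casoratian :: "complex poly \<Rightarrow> complex poly \<Rightarrow> (nat \<Rightarrow> complex poly) \<Rightarrow> nat \<Rightarrow> complex poly" where
  "casoratian A0 A1 u n = u n * u (Suc n) * A1 - u (Suc n) ^ 2 + u n ^ 2 * A0"

lemma casoratian_eq:
  assumes "binary_recurrence A0 A1 u"
  shows "casoratian A0 A1 u n = casoratian A0 A1 u 0 * (- A0) ^ n"
proof (induction n)
  case (Suc n)
  have "u (Suc (Suc n)) = A1 * u (Suc n) + A0 * u n"
    using assms unfolding binary_recurrence_def by simp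
  hence "casoratian A0 A1 u (Suc n) = casoratian A0 A1 u n * (- A0)"
    unfolding casoratian_def by (simp add: algebra_simps power2_eq_square)
  thus ?case using Suc by simp
qed simp

context poly_valuation
begin

text \<open>The two roots have valuations \<open>a = v(A\<^sub>1)\<close> and \<open>b - a\<close>, where \<open>b = v(A\<^sub>0)\<close> and \<open>a < b - a\<close>. Once a
  step of the sequence raises the valuation by less than \<open>b - a\<close>, the term \<open>A\<^sub>1 u\<^sub>n\<^sub>+\<^sub>1\<close> dominates
  forever and each step raises it by exactly \<open>a\<close>. A sequence without such a step would be
  a multiple of the powers of the smaller root, which the conserved quantity excludes.\<close>
lemma v_recurrence_eventually:
  assumes rec: "binary_recurrence A0 A1 u"
    and A: "A0 \<noteq> 0" "A1 \<noteq> 0" "2 * v A1 < v A0"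
    and E: "casoratian A0 A1 u 0 \<noteq> 0"
  obtains n0 where "\<And>n. u (Suc (n0 + n)) \<noteq> 0 \<and> v (u (Suc (n0 + n))) = v (u (Suc n0)) + int n * v A1"
proof -
  define a b where "a = v A1" and "b = v A0"
  have step: "u (Suc (Suc n)) = A1 * u (Suc n) + A0 * u n" for n
    using rec unfolding binary_recurrence_def by simp
  have En: "casoratian A0 A1 u n \<noteq> 0" for n
    using casoratian_eq[OF rec, of n] E A(1) by simp
  define good where "good = (\<lambda>n. u (Suc n) \<noteq> 0 \<and> (u n \<noteq> 0 \<longrightarrow> v (u (Suc n)) < v (u n) + b - a))"
  have good_Suc: "good (Suc n) \<and> v (u (Suc (Suc n))) = v (u (Suc n)) + a" if "good n" for n
  proof -
    have nz: "u (Suc n) \<noteq> 0" using that by (simp add: good_def)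
    have "u (Suc (Suc n)) \<noteq> 0 \<and> v (u (Suc (Suc n))) = v (A1 * u (Suc n))"
    proof (cases "u n = 0")
      case True
      thus ?thesis using step[of n] nz A by simp
    next
      case False
      hence "v (A1 * u (Suc n)) < v (A0 * u n)"
        using that nz A by (simp add: v_mult good_def a_def b_def)
      thus ?thesis using v_add_less[of "A1 * u (Suc n)" "A0 * u n"] step[of n] nz A False by simp
    qed
    thus ?thesis using nz A by (simp add: good_def v_mult a_def b_def)
  qed
  have "\<exists>n. good n"
  proof (rule ccontr)
    assume "\<not> (\<exists>n. good n)"
    hence bad: "\<And>n. u (Suc n) = 0 \<or> (u n \<noteq> 0 \<and> v (u n) + b - a \<le> v (u (Suc n)))"
      by (force simp: good_def)
    have nz: "u n \<noteq> 0" for n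
    proof
      assume "u n = 0"
      moreover from this have "u (Suc n) \<noteq> 0" using En[of n] by (auto simp: casoratian_def)
      ultimately show False using bad[of n] by simp
    qed
    have lower: "v (u 0) + int n * (b - a) \<le> v (u n)" for n
    proof (induction n)
      case (Suc n)
      show ?case using Suc bad[of n] nz[of "Suc n"] by (simp add: algebra_simps)
    qed simp
    \<comment> \<open>The valuation of the conserved quantity grows like \<open>n b\<close>, but all of its terms
      would have valuation at least about \<open>2 n (b - a)\<close>.\<close>
    have le: "2 * v (u 0) + 2 * int n * (b - a) + b \<le> v (casoratian A0 A1 u 0) + int n * b" for n
    proof -
      let ?k = "2 * v (u 0) + 2 * int n * (b - a) + b"
      have ab: "2 * a < b" using A(3) by (simp add: a_def b_def)
      have l: "v (u 0) + int n * (b - a) \<le> v (u n)"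
        "v (u 0) + int n * (b - a) + (b - a) \<le> v (u (Suc n))"
        using lower[of n] lower[of "Suc n"] by (simp_all add: algebra_simps)
      have "v_ge ?k (u n * u (Suc n) * A1)" "v_ge ?k (u (Suc n) ^ 2)" "v_ge ?k (u n ^ 2 * A0)"
        using l ab nz A by (simp_all add: v_ge_def v_mult v_power a_def b_def)
      hence "v_ge ?k (casoratian A0 A1 u n)"
        unfolding casoratian_def diff_conv_add_uminus by (intro v_ge_add v_ge_uminus)
      moreover have "v (casoratian A0 A1 u n) = v (casoratian A0 A1 u 0) + int n * b"
        using casoratian_eq[OF rec, of n] E A by (simp add: v_mult v_power v_uminus b_def)
      ultimately show ?thesis using En[of n] by (simp add: v_ge_def)
    qed
    have "int n \<le> v (casoratian A0 A1 u 0) - 2 * v (u 0) - b" for n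
    proof -
      have "b - 2 * a \<ge> 1" using A(3) by (simp add: a_def b_def)
      hence "int n * 1 \<le> int n * (b - 2 * a)" by (intro mult_left_mono) simp_all
      thus ?thesis using le[of n] by (simp add: algebra_simps)
    qed
    from this[of "nat (v (casoratian A0 A1 u 0) - 2 * v (u 0) - b + 1)"] show False by linarith
  qed
  then obtain n0 where n0: "good n0" by blast
  have "good (n0 + n) \<and> v (u (Suc (n0 + n))) = v (u (Suc n0)) + int n * a" for n
    using good_Suc n0 by (induction n) (auto simp: algebra_simps)
  thus ?thesis using that[of n0] by (simp add: good_def a_def)
qed

theorem v_recurrence_bound:
  assumes rec: "binary_recurrence A0 A1 u"
    and A: "A0 \<noteq> 0" "A1 \<noteq> 0" "2 * v A1 < v A0"
    and E: "casoratian A0 A1 u 0 \<noteq> 0" and \<Delta>: "\<Delta> \<noteq> 0"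
  obtains c where "\<And>n. u n \<noteq> 0 \<Longrightarrow>
    v (u n ^ 2 * \<Delta>) - v (casoratian A0 A1 u 0 * (- A0) ^ n) \<le> int c - int n"
proof -
  obtain n0 where n0: "\<And>n. u (Suc (n0 + n)) \<noteq> 0 \<and> v (u (Suc (n0 + n))) = v (u (Suc n0)) + int n * v A1"
    using v_recurrence_eventually[OF rec A E] by blast
  define t where "t = (\<lambda>n. v (u n ^ 2 * \<Delta>) - v (casoratian A0 A1 u 0 * (- A0) ^ n))"
  have t: "t n = 2 * v (u n) + v \<Delta> - v (casoratian A0 A1 u 0) - int n * v A0" if "u n \<noteq> 0" for n
    using that E \<Delta> A by (simp add: t_def v_mult v_power v_uminus)
  define c1 where "c1 = t (Suc n0) + int (Suc n0)"
  define c where "c = nat (\<bar>c1\<bar> + (\<Sum>n\<le>n0. \<bar>t n + int n\<bar>))"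
  have sum0: "0 \<le> (\<Sum>n\<le>n0. \<bar>t n + int n\<bar>)" by (intro sum_nonneg) simp
  have c: "int c = \<bar>c1\<bar> + (\<Sum>n\<le>n0. \<bar>t n + int n\<bar>)" using sum0 by (simp add: c_def)
  have "t n \<le> int c - int n" if "u n \<noteq> 0" for n
  proof (cases "n \<le> n0")
    case True
    hence "\<bar>t n + int n\<bar> \<le> (\<Sum>n\<le>n0. \<bar>t n + int n\<bar>)" by (intro member_le_sum) auto
    thus ?thesis using sum0 c by linarith
  next
    case False
    then obtain k where k: "n = Suc (n0 + k)" using less_imp_Suc_add by (meson not_le)
    have "t n = t (Suc n0) + int k * (2 * v A1 - v A0)"
      using t[OF that] t[of "Suc n0"] n0[of k] n0[of 0] unfolding k by (simp add: algebra_simps)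
    moreover have "int k * (2 * v A1 - v A0) \<le> int k * (- 1)"
      using A(3) by (intro mult_left_mono) simp_all
    ultimately have "t n \<le> c1 - int n" using k by (simp add: c1_def)
    thus ?thesis using sum0 c by linarith
  qed
  thus ?thesis using that unfolding t_def by blast
qed

end

lemma poly_valuation_degree: "poly_valuation (\<lambda>p. - int (degree p))"
proof
  fix p q :: "complex poly"
  show "min (- int (degree p)) (- int (degree q)) \<le> - int (degree (p + q))"
    using degree_add_le_max[of p q] by linarith
qed (simp_all add: degree_mult_eq)

lemma poly_valuation_order: "poly_valuation (\<lambda>p. int (order a p))"
proof
  fix p q :: "complex poly" assume "p + q \<noteq> 0"
  moreover have "[:- a, 1:] ^ min (order a p) (order a q) dvd p + q"
    by (intro dvd_add; subst order_divides) simp_all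
  ultimately show "min (int (order a p)) (int (order a q)) \<le> int (order a (p + q))"
    by (subst (asm) order_divides) auto
qed (simp_all add: order_mult order_0I)

lemma dvd_if_order_le:
  fixes p q :: "complex poly"
  assumes "p \<noteq> 0" "\<And>a. order a p \<le> order a q" "q \<noteq> 0"
  shows "p dvd q"
  using assms
proof (induction "degree p" arbitrary: p q)
  case 0
  hence "is_unit p" by (metis degree_eq_zeroE is_unit_triv pCons_0_0)
  thus ?case by (rule unit_imp_dvd)
next
  case (Suc n)
  have "\<not> constant (poly p)" using Suc(2) by (simp add: constant_degree)
  then obtain a where "poly p a = 0" using fundamental_theorem_of_algebra by blast
  moreover from this have "poly q a = 0" using Suc(3) Suc(4)[of a] by (metis order_root le_zero_eq)
  ultimately obtain p' q' where p': "p = [:- a, 1:] * p'" and q': "q = [:- a, 1:] * q'"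
    by (metis dvdE poly_eq_0_iff_dvd)
  have nz: "p' \<noteq> 0" "q' \<noteq> 0" using Suc(3,5) p' q' by auto
  have "degree p = Suc (degree p')" unfolding p' using nz by (subst degree_mult_eq) auto
  moreover have "order b p' \<le> order b q'" for b
  proof -
    have "order b p = order b [:- a, 1:] + order b p'" "order b q = order b [:- a, 1:] + order b q'"
      using Suc(3,5) unfolding p' q' by (auto intro!: order_mult simp del: mult_pCons_left)
    thus ?thesis using Suc(4)[of b] by simp
  qed
  ultimately have "p' dvd q'" using Suc(1)[of p' q'] Suc(2) nz by simp
  thus ?case unfolding p' q' by (intro mult_dvd_mono) simp
qed

text \<open>If no finite place separates the two characteristic roots, then \<open>A\<^sub>0\<close> divides
  \<open>A\<^sub>1\<^sup>2\<close>, and the place at infinity does it unless the quotient is constant.\<close>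
lemma ex_separating_valuation:
  assumes "A0 \<noteq> 0" "A1 \<noteq> 0" "\<And>c. A1\<^sup>2 \<noteq> smult c A0"
  obtains v \<pi> where "poly_valuation v" "\<pi> \<noteq> 0" "degree \<pi> \<le> 1" "\<bar>v \<pi>\<bar> = 1" "2 * v A1 < v A0"
proof (cases "A0 dvd A1\<^sup>2")
  case True
  then obtain q where q: "A1\<^sup>2 = A0 * q" by blast
  have "degree q \<noteq> 0"
  proof
    assume "degree q = 0"
    then obtain c where "q = [:c:]" by (meson degree_eq_zeroE)
    thus False using q assms(3)[of c] by simp
  qed
  moreover have "2 * degree A1 = degree A0 + degree q"
    using q assms(1,2) by (metis degree_mult_eq degree_power_eq mult_zero_right power_not_zero)
  ultimately show ?thesis
    using that[OF poly_valuation_degree, of "[:0, 1:]"] by simp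
next
  case False
  then obtain a where a: "order a A0 > order a (A1\<^sup>2)"
    using dvd_if_order_le[OF assms(1), of "A1\<^sup>2"] assms(2) by (metis not_le power_not_zero)
  moreover have "order a (A1\<^sup>2) = 2 * order a A1"
    using assms(2) by (simp add: power2_eq_square order_mult)
  moreover have "order a [:- a, 1:] = 1" using order_power_n_n[of a 1] by simp
  ultimately show ?thesis
    using that[OF poly_valuation_order[of a], of "[:- a, 1:]"] by simp
qed

section \<open>Counting independent elements\<close>

context conjugate_point
begin

text \<open>Write the rational function as \<open>A / B\<close> with \<open>A\<close>, \<open>B\<close> of weight \<open>M\<close> and consider
  \<open>y\<^sup>j \<pi>\<^sup>l A\<^sup>i B\<^sup>q\<^sup>-\<^sup>i\<close> for \<open>j < d\<close>, \<open>l < N\<close>, \<open>i \<le> q\<close>. Up to the common factor \<open>B\<^sup>q / R\<^sup>q\<close> they are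
  \<open>y\<^sup>j \<pi>\<^sup>l P\<^sup>i R\<^sup>q\<^sup>-\<^sup>i\<close>. The powers of \<open>y\<close> are independent over \<open>\<complex>(x)\<close>, and for fixed \<open>j\<close> the
  valuations of the polynomials are distinct, as \<open>\<bar>v P - v R\<bar> \<ge> N\<close> and \<open>\<bar>v \<pi>\<bar> = 1\<close>. So there are
  \<open>d N (q + 1)\<close> independent elements of weight at most \<open>d + N + q M\<close>, against a dimension of at
  most \<open>4 d (d + N + q M + 1)\<close>.\<close>
theorem valuation_bound:
  assumes val: "poly_valuation v" and \<pi>: "\<pi> \<noteq> 0" "degree \<pi> \<le> 1" "\<bar>v \<pi>\<bar> = 1"
    and PR: "P \<noteq> 0" "R \<noteq> 0" "fun_of P / fun_of R \<in> Q M"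
    and N: "int N \<le> \<bar>v P - v R\<bar>"
  shows "N \<le> 4 * M"
proof (rule ccontr)
  assume "\<not> N \<le> 4 * M"
  hence NM: "4 * M + 1 \<le> N" by simp
  interpret poly_valuation v by (rule val)
  obtain d where d: "d > 0" "\<And>P. degree P < d \<Longrightarrow> bieval P y = 0 \<Longrightarrow> P = 0"
    and dim: "\<And>k. \<exists>T. finite T \<and> card T \<le> 4 * d * (k + 1) \<and> (\<forall>z. V k z \<longrightarrow> z \<in> af.span T)"
    using weight_space_bound by blast
  obtain A B where AB: "fun_of P / fun_of R = A / B" "V M A" "V M B" "B \<noteq> 0"
    using PR(3) by (rule Q_E)
  have cross: "A * fun_of R = B * fun_of P" using AB(1,4) PR(2) by (simp add: frac_eq_eq mult_ac)
  \<comment> \<open>Large enough for \<open>q (N - 4 M)\<close> to outweigh the terms that do not depend on \<open>q\<close>.\<close>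
  define q where "q = 4 * (d + N + 1)"
  define k where "k = d + N + q * M"
  obtain T where T: "finite T" "card T \<le> 4 * d * (k + 1)" "\<And>z. V k z \<Longrightarrow> z \<in> af.span T"
    using dim[of k] by blast
  define I where "I = {..<d} \<times> {..<N} \<times> {..q}"
  define b where "b = (\<lambda>(j, l, i). y ^ j * fun_of \<pi> ^ l * (A ^ i * B ^ (q - i)))"
  have "4 * (k + 1) = q * (4 * M + 1)" by (simp add: k_def q_def algebra_simps)
  also have "\<dots> \<le> q * N" using NM by (rule mult_le_mono2)
  also have "\<dots> < N * (q + 1)" using NM by simp
  finally have "d * (4 * (k + 1)) < d * (N * (q + 1))" using d(1) by simp
  moreover have "card T \<le> d * (4 * (k + 1))" using T(2) by (simp only: mult_ac)
  ultimately have "card T < d * (N * (q + 1))" by linarith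
  hence card: "card T < card I" by (simp add: I_def card_cartesian_product)
  have finI: "finite I" by (simp add: I_def)
  have span: "b t \<in> af.span T" if t: "t \<in> I" for t
  proof -
    obtain j l i where jli: "t = (j, l, i)" "j < d" "l < N" "i \<le> q" using t by (auto simp: I_def)
    have "V (j * 1 + l * 1 + (i * M + (q - i) * M)) (b t)"
      unfolding jli(1) b_def prod.case
      by (intro V.mult V_power V.y V_fun_of \<pi>(2) AB(2,3))
    moreover have "i * M + (q - i) * M = q * M" using jli(4) by (simp add: distrib_right[symmetric])
    hence "j * 1 + l * 1 + (i * M + (q - i) * M) \<le> k" using jli by (simp add: k_def)
    ultimately show ?thesis by (intro T(3)) (rule V.up)
  qed
  obtain c where c: "(\<Sum>t\<in>I. af_const (c t) * b t) = 0" "\<exists>t\<in>I. c t \<noteq> 0"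
    using relation_if_many[OF T(1) finI card, of b] span by blast
  define f where "f = (\<lambda>(l, i). \<pi> ^ l * P ^ i * R ^ (q - i))"
  define W where "W = {..<N} \<times> {..q}"
  define G where "G = (\<lambda>j. \<Sum>t\<in>W. smult (c (j, t)) (f t))"
  have bf: "b (j, t) * fun_of R ^ q = B ^ q * (fun_of (f t) * y ^ j)" if tW: "t \<in> W" for j t
  proof -
    obtain l i where t: "t = (l, i)" "i \<le> q" using tW by (auto simp: W_def)
    have pw: "z ^ q = z ^ i * z ^ (q - i)" for z :: algfun using t(2) by (simp add: power_add[symmetric])
    have "A ^ i * B ^ (q - i) * fun_of R ^ q = (A * fun_of R) ^ i * (B ^ (q - i) * fun_of R ^ (q - i))"
      by (simp add: pw[of "fun_of R"] power_mult_distrib mult_ac)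
    also have "\<dots> = B ^ q * (fun_of P ^ i * fun_of R ^ (q - i))"
      by (simp add: cross pw[of B] power_mult_distrib mult_ac)
    finally have *: "A ^ i * B ^ (q - i) * fun_of R ^ q = B ^ q * (fun_of P ^ i * fun_of R ^ (q - i))" .
    have "b (j, t) * fun_of R ^ q = y ^ j * fun_of \<pi> ^ l * (A ^ i * B ^ (q - i) * fun_of R ^ q)"
      by (simp add: b_def t mult_ac)
    thus ?thesis unfolding * by (simp add: f_def t mult_ac)
  qed
  have "B ^ q * (\<Sum>j<d. fun_of (G j) * y ^ j) = (\<Sum>j<d. \<Sum>t\<in>W. af_const (c (j, t)) * (B ^ q * (fun_of (f t) * y ^ j)))"
  proof -
    have "fun_of (smult a p) = af_const a * fun_of p" for a p
      using fun_of_simps(5)[of "[:a:]" p] by (simp add: fun_of_const)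
    thus ?thesis by (simp add: G_def fun_of_sum sum_distrib_left sum_distrib_right mult_ac)
  qed
  also have "\<dots> = (\<Sum>j<d. \<Sum>t\<in>W. af_const (c (j, t)) * b (j, t) * fun_of R ^ q)"
    by (intro sum.cong refl) (simp add: bf mult.assoc)
  also have "\<dots> = (\<Sum>t\<in>I. af_const (c t) * b t) * fun_of R ^ q"
    unfolding I_def W_def[symmetric] by (simp add: sum.cartesian_product sum_distrib_right case_prod_beta)
  also have "\<dots> = 0" using c(1) by simp
  finally have rel: "(\<Sum>j<d. fun_of (G j) * y ^ j) = 0" using AB(4) by simp
  define H where "H = (\<Sum>j<d. monom (G j) j)"
  have coH: "coeff H i = (if i < d then G i else 0)" for i
    by (simp add: H_def coeff_sum coeff_monom)
  have "degree H \<le> d - 1" using d(1) by (intro degree_le) (auto simp: coH)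
  moreover have "{..d - 1} = {..<d}" using d(1) by auto
  ultimately have "bieval H y = (\<Sum>j<d. fun_of (G j) * y ^ j)"
    using bieval_altdef[of H "d - 1" y] by (simp add: coH)
  hence "H = 0" using rel \<open>degree H \<le> d - 1\<close> d(1) by (intro d(2)) auto
  hence G0: "G j = 0" if "j < d" for j using that coH[of j] by simp
  have inj: "inj_on (\<lambda>t. v (f t)) W"
  proof (rule inj_onI)
    fix t t' assume "t \<in> W" "t' \<in> W" and eq: "v (f t) = v (f t')"
    then obtain l i l' i' where t: "t = (l, i)" "t' = (l', i')" "l < N" "l' < N" "i \<le> q" "i' \<le> q"
      by (auto simp: W_def)
    have "int l * v \<pi> + int i * v P + int (q - i) * v R = int l' * v \<pi> + int i' * v P + int (q - i') * v R"
      using eq \<pi>(1) PR(1,2) by (simp add: t(1,2) f_def v_mult v_power)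
    hence e: "(int l - int l') * v \<pi> = (int i' - int i) * (v P - v R)"
      using t(5,6) by (simp add: of_nat_diff algebra_simps)
    have "\<bar>int l - int l'\<bar> = \<bar>int i' - int i\<bar> * \<bar>v P - v R\<bar>"
      using arg_cong[OF e, of abs] \<pi>(3) by (simp add: abs_mult)
    moreover have "\<bar>int l - int l'\<bar> < int N" using t(3,4) by linarith
    moreover have "\<bar>int i' - int i\<bar> * \<bar>v P - v R\<bar> \<ge> 1 * int N" if "i \<noteq> i'"
      using that N by (intro mult_mono) auto
    ultimately have "i = i'" by force
    moreover from this have "l = l'" using e \<pi>(3) by auto
    ultimately show "t = t'" by (simp add: t)
  qed
  have "c (j, t) = 0" if "j < d" "t \<in> W" for j t
  proof (rule v_independent[of W f "\<lambda>t. c (j, t)", OF _ _ inj _ that(2)])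
    show "(\<Sum>i\<in>W. smult (c (j, i)) (f i)) = 0" using G0[OF that(1)] by (simp add: G_def)
  qed (use \<pi>(1) PR(1,2) in \<open>auto simp: W_def f_def\<close>)
  thus False using c(2) by (auto simp: I_def W_def)
qed

end

section \<open>The characteristic roots and the eight-term relation\<close>

lemma numeral_algfun: "(2 :: algfun) \<noteq> 0" "(2 :: algfun) = af_const 2" "(4 :: algfun) = fun_of 4"
proof -
  show 2: "(2 :: algfun) = af_const 2" using af_const_simps(3)[of 1 1] by simp
  show "(2 :: algfun) \<noteq> 0" unfolding 2 by simp
  show "(4 :: algfun) = fun_of 4" using af_eval_numeral[of "num.Bit0 (num.Bit0 num.One)" af_x] by simp
qed

lemma halves_algfun: "(z :: algfun) / 2 + z / 2 = z" "(z :: algfun) / 2 = af_const (1 / 2) * z"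
proof -
  show 1: "z / 2 + z / 2 = z" using numeral_algfun(1) by (simp add: add_divide_distrib[symmetric] mult_2[symmetric])
  have "af_const (1 / 2) * 2 = 1" by (simp add: numeral_algfun(2) af_const_simps(5)[symmetric] del: af_const_simps(5))
  hence "af_const (1 / 2) * z = af_const (1 / 2) * 2 * (z / 2)" using numeral_algfun(1) by simp
  thus "z / 2 = af_const (1 / 2) * z" using \<open>af_const (1 / 2) * 2 = 1\<close> by simp
qed

lemma char_roots:
  assumes "\<beta>1 \<noteq> \<beta>2" "poly (char_poly_at A0 A1 z) \<beta>1 = 0" "poly (char_poly_at A0 A1 z) \<beta>2 = 0"
  shows "\<beta>1 + \<beta>2 = af_eval A1 z" "\<beta>1 * \<beta>2 = - af_eval A0 z"
    "(\<beta>1 - \<beta>2)\<^sup>2 = af_eval (A1\<^sup>2 + 4 * A0) z"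
proof -
  have e: "\<beta>1 * \<beta>1 = af_eval A1 z * \<beta>1 + af_eval A0 z" "\<beta>2 * \<beta>2 = af_eval A1 z * \<beta>2 + af_eval A0 z"
    using assms(2,3) by (simp_all add: char_poly_at_def algebra_simps)
  have "(\<beta>1 - \<beta>2) * (\<beta>1 + \<beta>2) = \<beta>1 * \<beta>1 - \<beta>2 * \<beta>2" by (simp add: algebra_simps)
  also have "\<dots> = (\<beta>1 - \<beta>2) * af_eval A1 z" unfolding e by (simp add: algebra_simps)
  finally show s: "\<beta>1 + \<beta>2 = af_eval A1 z" using assms(1) by simp
  have "\<beta>1 * \<beta>2 = \<beta>1 * (\<beta>1 + \<beta>2) - \<beta>1 * \<beta>1" by (simp add: algebra_simps)
  also have "\<dots> = - af_eval A0 z" unfolding s e by (simp add: algebra_simps)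
  finally show p: "\<beta>1 * \<beta>2 = - af_eval A0 z" .
  have "(\<beta>1 - \<beta>2)\<^sup>2 = (\<beta>1 + \<beta>2)\<^sup>2 - 4 * (\<beta>1 * \<beta>2)" by (simp add: power2_eq_square algebra_simps)
  thus "(\<beta>1 - \<beta>2)\<^sup>2 = af_eval (A1\<^sup>2 + 4 * A0) z" unfolding s p by simp
qed

lemma alpha_roots:
  assumes "simple_rec A0 A1"
  shows "alpha1 A0 A1 + alpha2 A0 A1 = fun_of A1" "alpha1 A0 A1 * alpha2 A0 A1 = - fun_of A0"
    "(alpha1 A0 A1 - alpha2 A0 A1)\<^sup>2 = fun_of (A1\<^sup>2 + 4 * A0)"
proof -
  define s where "s = af_sqrt (af_eval (A1 ^ 2 + 4 * A0) af_x)"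
  have s: "s * s = fun_of A1 * fun_of A1 + 4 * fun_of A0"
    using af_sqrt_power2[of "fun_of (A1\<^sup>2 + 4 * A0)"]
    by (simp add: s_def power2_eq_square numeral_algfun(3))
  define t where "t = s / 2"
  define q where "q = fun_of A1 / 2"
  have tq: "s = t + t" "fun_of A1 = q + q" using halves_algfun(1) by (simp_all add: t_def q_def)
  have \<alpha>: "alpha1 A0 A1 = q - t" "alpha2 A0 A1 = q + t"
    unfolding alpha1_def alpha2_def s_def[symmetric] t_def q_def
    by (simp_all add: diff_divide_distrib add_divide_distrib)
  show sum: "alpha1 A0 A1 + alpha2 A0 A1 = fun_of A1" by (simp add: \<alpha> tq)
  have "4 * (t * t) = 4 * (q * q + fun_of A0)" using s unfolding tq by (simp add: algebra_simps)
  hence tt: "t * t = q * q + fun_of A0"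
    using numeral_algfun(3) by (simp del: mult_cancel_left add: mult_left_cancel)
  thus prod: "alpha1 A0 A1 * alpha2 A0 A1 = - fun_of A0" by (simp add: \<alpha> algebra_simps)
  have "(alpha1 A0 A1 - alpha2 A0 A1)\<^sup>2 = (alpha1 A0 A1 + alpha2 A0 A1)\<^sup>2 - 4 * (alpha1 A0 A1 * alpha2 A0 A1)"
    by (simp add: power2_eq_square algebra_simps)
  thus "(alpha1 A0 A1 - alpha2 A0 A1)\<^sup>2 = fun_of (A1\<^sup>2 + 4 * A0)"
    unfolding sum prod by (simp add: numeral_algfun(3))
qed

text \<open>If \<open>A\<^sub>1\<^sup>2 = c A\<^sub>0\<close>, then the quotient \<open>\<rho>\<close> of the roots satisfies
  \<open>\<rho>\<^sup>2 + (2 + c) \<rho> + 1 = 0\<close>, so it is constant.\<close>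
lemma nondegenerate_coefficients:
  assumes simple: "simple_rec A0 A1" and nd: "nondegenerate_rec A0 A1"
  shows "A0 \<noteq> 0" "A1 \<noteq> 0" "A1\<^sup>2 \<noteq> smult c A0"
proof -
  note al = alpha_roots[OF simple]
  define \<rho> where "\<rho> = alpha1 A0 A1 / alpha2 A0 A1"
  have nc: "\<rho> \<noteq> af_const a" for a using nd by (auto simp: nondegenerate_rec_def \<rho>_def)
  have "\<rho> \<noteq> 0" using nc[of 0] by simp
  hence a12: "alpha1 A0 A1 \<noteq> 0" "alpha2 A0 A1 \<noteq> 0" by (auto simp: \<rho>_def)
  thus "A0 \<noteq> 0" using al(2) by auto
  have a1: "alpha1 A0 A1 = \<rho> * alpha2 A0 A1" using a12 by (simp add: \<rho>_def)
  show "A1 \<noteq> 0"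
  proof
    assume "A1 = 0"
    hence "(\<rho> + 1) * alpha2 A0 A1 = 0" using al(1) a1 by (simp add: distrib_right)
    hence "\<rho> = af_const (- 1)" using a12(2) by (simp add: eq_neg_iff_add_eq_0)
    thus False using nc by blast
  qed
  show "A1\<^sup>2 \<noteq> smult c A0"
  proof
    assume "A1\<^sup>2 = smult c A0"
    hence "fun_of (A1\<^sup>2) = af_const c * fun_of A0"
      using fun_of_simps(5)[of "[:c:]" A0] by (simp add: fun_of_const del: fun_of_simps)
    hence "(alpha1 A0 A1 + alpha2 A0 A1)\<^sup>2 + af_const c * (alpha1 A0 A1 * alpha2 A0 A1) = 0"
      unfolding al by simp
    hence "(alpha2 A0 A1)\<^sup>2 * af_eval [:1, 2 + c, 1:] \<rho> = 0"
      unfolding a1 by (simp add: power2_eq_square algebra_simps numeral_algfun(2)[symmetric])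
    hence "af_eval [:1, 2 + c, 1:] \<rho> = 0" using a12 by simp
    thus False using af_eval_eq_0_imp_const[of "[:1, 2 + c, 1:]" \<rho>] nc by auto
  qed
qed

lemma binet:
  assumes simple: "simple_rec A0 A1" and rec: "binary_recurrence A0 A1 u"
  shows "fun_of (u n) = sigma1 A0 A1 u * alpha1 A0 A1 ^ n + sigma2 A0 A1 u * alpha2 A0 A1 ^ n"
proof -
  note al = alpha_roots[OF simple]
  define a b where "a = alpha1 A0 A1" and "b = alpha2 A0 A1"
  define S T where "S = sigma1 A0 A1 u" and "T = sigma2 A0 A1 u"
  have ab: "a - b \<noteq> 0" using simple by (simp add: simple_rec_def a_def b_def)
  have ST: "S * (a - b) = fun_of (u 1) - fun_of (u 0) * b" "T * (a - b) = fun_of (u 0) * a - fun_of (u 1)"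
    using ab by (simp_all add: S_def T_def sigma1_def sigma2_def a_def b_def)
  have sq: "a * a = fun_of A1 * a + fun_of A0" "b * b = fun_of A1 * b + fun_of A0"
  proof -
    have A: "fun_of A1 = a + b" "fun_of A0 = - (a * b)"
      using al(1,2) by (simp_all add: a_def b_def)
    show "a * a = fun_of A1 * a + fun_of A0" "b * b = fun_of A1 * b + fun_of A0"
      unfolding A by (simp_all add: algebra_simps)
  qed
  have "(S + T) * (a - b) = fun_of (u 0) * (a - b)"
    unfolding distrib_right ST by (simp add: algebra_simps)
  hence init0: "fun_of (u 0) = S + T" using ab by simp
  have "(S * a + T * b) * (a - b) = (S * (a - b)) * a + (T * (a - b)) * b" by (simp add: algebra_simps)
  also have "\<dots> = fun_of (u 1) * (a - b)" unfolding ST by (simp add: algebra_simps)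
  finally have init1: "fun_of (u (Suc 0)) = S * a + T * b" using ab by simp
  have "fun_of (u n) = S * a ^ n + T * b ^ n \<and> fun_of (u (Suc n)) = S * a ^ Suc n + T * b ^ Suc n"
  proof (induction n)
    case 0
    show ?case using init0 init1 by simp
  next
    case (Suc n)
    have "fun_of (u (Suc (Suc n))) = fun_of A1 * fun_of (u (Suc n)) + fun_of A0 * fun_of (u n)"
      using rec unfolding binary_recurrence_def by simp
    also have "\<dots> = S * a ^ n * (fun_of A1 * a + fun_of A0) + T * b ^ n * (fun_of A1 * b + fun_of A0)"
      using Suc by (simp add: algebra_simps)
    also have "\<dots> = S * a ^ Suc (Suc n) + T * b ^ Suc (Suc n)"
      unfolding sq[symmetric] by (simp add: mult_ac)
    finally show ?case using Suc by simp
  qed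
  thus ?thesis by (simp add: a_def b_def S_def T_def)
qed

lemma sigma_product:
  assumes simple: "simple_rec A0 A1"
  shows "sigma1 A0 A1 u * sigma2 A0 A1 u * fun_of (A1\<^sup>2 + 4 * A0) = fun_of (casoratian A0 A1 u 0)"
proof -
  note al = alpha_roots[OF simple]
  define a b where "a = alpha1 A0 A1" and "b = alpha2 A0 A1"
  define p q where "p = fun_of (u 0)" and "q = fun_of (u 1)"
  have ab: "a - b \<noteq> 0" using simple by (simp add: simple_rec_def a_def b_def)
  have "sigma1 A0 A1 u * sigma2 A0 A1 u * (a - b)\<^sup>2 = (q - p * b) * (p * a - q)"
    using ab by (simp add: sigma1_def sigma2_def a_def[symmetric] b_def[symmetric] p_def q_def
        power2_eq_square)
  also have "\<dots> = p * q * (a + b) - q\<^sup>2 + p\<^sup>2 * (- (a * b))" by (simp add: algebra_simps power2_eq_square)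
  also have "\<dots> = fun_of (casoratian A0 A1 u 0)"
    using al(1,2) by (simp add: a_def b_def p_def q_def casoratian_def)
  finally show ?thesis unfolding a_def b_def al(3) .
qed

lemma degree_recurrence_le:
  assumes rec: "binary_recurrence A0 A1 u"
    and "degree A0 \<le> k" "degree A1 \<le> k" "degree (u 0) \<le> k" "degree (u 1) \<le> k"
  shows "degree (u n) \<le> k * (n + 1)"
proof -
  have "degree (u n) \<le> k * (n + 1) \<and> degree (u (Suc n)) \<le> k * (Suc n + 1)"
  proof (induction n)
    case (Suc n)
    have u: "u (Suc (Suc n)) = A1 * u (Suc n) + A0 * u n"
      using rec unfolding binary_recurrence_def by simp
    have "degree (A1 * u (Suc n)) \<le> k * (Suc (Suc n) + 1)" "degree (A0 * u n) \<le> k * (Suc (Suc n) + 1)"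
      using Suc assms degree_mult_le[of A1 "u (Suc n)"] degree_mult_le[of A0 "u n"] by simp_all
    thus ?case using Suc by (simp only: u degree_add_le)
  qed (use assms in simp)
  thus ?thesis by blast
qed

context conjugate_point
begin

lemma V_half: "V k z \<Longrightarrow> V k (z / 2)"
  unfolding halves_algfun(2) using V_mult[OF V_const(1)[of 0]] by simp

lemma coefficient_in_Q:
  assumes "V k p" "V k q" "V k b" "V k c" "c \<noteq> 0"
  shows "(p - q * b) / c \<in> Q (2 * k)" "(q * b - p) / c \<in> Q (2 * k)"
proof -
  have "V (2 * k) (q * b)" "V (2 * k) p" "V (2 * k) c"
    using V_mult[OF assms(2,3), of "2 * k"] V.up[OF assms(1)] V.up[OF assms(4)] by simp_all
  thus "(p - q * b) / c \<in> Q (2 * k)" "(q * b - p) / c \<in> Q (2 * k)"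
    using assms(5) V_diff by (auto intro!: Q_I)
qed

text \<open>The bound is linear in the weights \<open>k\<close> and \<open>w\<close> and uniform in the exponents \<open>i\<close> and \<open>j\<close>,
  which is what makes it usable for exponents that are to be bounded themselves.\<close>
theorem ratio_of_terms_bound:
  assumes nosub: "no_proper_vanishing_subsum
      [a1 * b1 ^ i, a2 * b2 ^ i, a1 * b1 ^ j, a2 * b2 ^ j,
       - (c1 * d1 ^ i), - (c2 * d2 ^ i), - (c1 * d1 ^ j), - (c2 * d2 ^ j)]"
    and rel: "a1 * b1 ^ i + a2 * b2 ^ i + (a1 * b1 ^ j + a2 * b2 ^ j)
      = c1 * d1 ^ i + c2 * d2 ^ i + (c1 * d1 ^ j + c2 * d2 ^ j)"
    and Q: "{a1, a2, b1, b2, c1, c2, d1, d2} \<subseteq> Q k"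
    and nz: "b1 \<noteq> 0" "b2 \<noteq> 0" "d1 \<noteq> 0" "d2 \<noteq> 0"
  shows "a1 * b1 ^ j / (a2 * b2 ^ j) \<in> Q (4 ^ (6 * 8 + 8 * 8) * (6 * k + 2 * w))"
    "a1 \<noteq> 0" "a2 \<noteq> 0" "a1 * b1 ^ j + a2 * b2 ^ j \<noteq> 0"
proof -
  define ts where "ts = [a1 * b1 ^ i, a2 * b2 ^ i, a1 * b1 ^ j, a2 * b2 ^ j,
       - (c1 * d1 ^ i), - (c2 * d2 ^ i), - (c1 * d1 ^ j), - (c2 * d2 ^ j)]"
  define f where "f = (\<lambda>l. ts ! l)"
  have f: "f 0 = a1 * b1 ^ i" "f 1 = a2 * b2 ^ i" "f 2 = a1 * b1 ^ j" "f 3 = a2 * b2 ^ j"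
     "f 4 = - (c1 * d1 ^ i)" "f 5 = - (c2 * d2 ^ i)" "f 6 = - (c1 * d1 ^ j)" "f 7 = - (c2 * d2 ^ j)"
    by (simp_all add: f_def ts_def)
  have I8: "{..<8 :: nat} = {0, 1, 2, 3, 4, 5, 6, 7}" by auto
  have ns: "(\<Sum>l\<in>J. f l) \<noteq> 0" if "J \<noteq> {}" "J \<subset> {..<8}" for J
  proof -
    have "length ts = 8" by (simp add: ts_def)
    moreover have "no_proper_vanishing_subsum ts" using nosub by (simp only: ts_def)
    ultimately show ?thesis using that by (simp add: no_proper_vanishing_subsum_def f_def)
  qed
  have psubset: "J \<subset> {..<8}" if "J \<subseteq> {..<8}" "card J < 8" for J :: "nat set"
  proof (rule psubsetI[OF that(1)], rule notI)
    assume "J = {..<8}"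
    hence "card J = card {..<8 :: nat}" by (rule arg_cong)
    thus False using that(2) by simp
  qed
  have f0: "f l \<noteq> 0" if "l \<in> {..<8}" for l
  proof -
    have "{l} \<subset> {..<8}" using that by (intro psubset) simp_all
    from ns[OF _ this] show ?thesis by simp
  qed
  show a: "a1 \<noteq> 0" "a2 \<noteq> 0" using f0[of 0] f0[of 1] f by auto
  have c: "c1 \<noteq> 0" "c2 \<noteq> 0" using f0[of 4] f0[of 5] f by auto
  have "{2, 3 :: nat} \<subset> {..<8}" by (intro psubset) simp_all
  from ns[OF _ this] show "a1 * b1 ^ j + a2 * b2 ^ j \<noteq> 0" by (simp add: f)
  have neg: "af_deriv (- z) / (- z) = af_deriv z / z" for z by simp
  have sum0: "(\<Sum>l<8. f l) = 0"
    unfolding I8 using rel by (simp add: f f(2)[unfolded One_nat_def] algebra_simps)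
  have ld: "af_deriv (p * q ^ n) / (p * q ^ n) \<in> Q (6 * k + 2 * w)"
    if "(p, q) \<in> {(a1, b1), (a2, b2), (c1, d1), (c2, d2)}" for p q n
    using that Q nz a c by (intro log_deriv_in_Q) auto
  have "\<forall>l\<in>{..<8}. af_deriv (f l) / f l \<in> Q (6 * k + 2 * w)"
    unfolding I8 ball_simps f neg by (intro conjI ld TrueI) simp_all
  hence logs: "af_deriv (f l) / f l \<in> Q (6 * k + 2 * w)" if "l < 8" for l using that by simp
  interpret complexity_filtration "\<lambda>l. Q (4 ^ l * (6 * k + 2 * w))"
    by (rule complexity_filtration_Q) simp
  have "f 2 / f 3 \<in> Q (4 ^ (6 * card {..<8 :: nat} + card {..<8 :: nat} * card {..<8 :: nat}) * (6 * k + 2 * w))"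
  proof (rule ratio_in_filtration[where f = f])
    fix l :: nat assume "l \<in> {..<8}"
    thus "af_deriv (f l) / f l \<in> Q (4 ^ 0 * (6 * k + 2 * w))" using logs by simp
  next
    fix J :: "nat set" assume "J \<noteq> {}" "J \<subset> {..<8}"
    thus "(\<Sum>l\<in>J. f l) \<noteq> 0" by (rule ns)
  next
    fix l :: nat assume "l \<in> {..<8}"
    thus "f l \<noteq> 0" by (rule f0)
  next
    show "(\<Sum>l<8. f l) = 0" by (rule sum0)
  qed simp_all
  thus "a1 * b1 ^ j / (a2 * b2 ^ j) \<in> Q (4 ^ (6 * 8 + 8 * 8) * (6 * k + 2 * w))"
    by (simp only: f card_lessThan)
qed

end

section \<open>The degree bound\<close>

theorem theorem2p4:
  fixes A0 A1 :: "complex poly" and u :: "nat \<Rightarrow> complex poly"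
  assumes "binary_recurrence A0 A1 u"
    and "simple_rec A0 A1"
    and "nondegenerate_rec A0 A1"
  shows "\<exists>C :: real. C > 0 \<and>
    (\<forall>(n1 :: nat) (n2 :: nat) (g :: complex poly) (h :: complex poly)
       (y :: algfun) (\<beta>1 :: algfun) (\<beta>2 :: algfun) (\<delta>1 :: algfun) (\<delta>2 :: algfun).
       n1 \<le> n2 \<longrightarrow>
       u n1 + u n2 = pcompose g h \<longrightarrow>
       indecomposable h \<longrightarrow> \<not> cyclic_poly h \<longrightarrow> \<not> dihedral_poly h \<longrightarrow>
       y \<noteq> af_x \<longrightarrow>
       poly (map_poly af_const h - [:af_eval h af_x:]) y = 0 \<longrightarrow>
       conjugate_data A0 A1 u y \<beta>1 \<beta>2 \<delta>1 \<delta>2 \<longrightarrow>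
       no_proper_vanishing_subsum
         [sigma1 A0 A1 u * alpha1 A0 A1 ^ n1, sigma2 A0 A1 u * alpha2 A0 A1 ^ n1,
          sigma1 A0 A1 u * alpha1 A0 A1 ^ n2, sigma2 A0 A1 u * alpha2 A0 A1 ^ n2,
          - (\<delta>1 * \<beta>1 ^ n1), - (\<delta>2 * \<beta>2 ^ n1),
          - (\<delta>1 * \<beta>1 ^ n2), - (\<delta>2 * \<beta>2 ^ n2)] \<longrightarrow>
       real (degree g) \<le> C)"
proof -
  note al = alpha_roots[OF assms(2)] and nd = nondegenerate_coefficients[OF assms(2,3)]
  define \<Delta> where "\<Delta> = A1\<^sup>2 + 4 * A0"
  define E where "E = casoratian A0 A1 u 0"
  define \<alpha>1 \<alpha>2 \<sigma>1 \<sigma>2 where "\<alpha>1 = alpha1 A0 A1" and "\<alpha>2 = alpha2 A0 A1"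
    and "\<sigma>1 = sigma1 A0 A1 u" and "\<sigma>2 = sigma2 A0 A1 u"
  have \<alpha>12: "\<alpha>1 - \<alpha>2 \<noteq> 0" using assms(2) by (simp add: simple_rec_def \<alpha>1_def \<alpha>2_def)
  have \<Delta>: "(\<alpha>1 - \<alpha>2)\<^sup>2 = fun_of \<Delta>"
    using al(3) by (simp only: \<alpha>1_def \<alpha>2_def \<Delta>_def)
  have \<Delta>0: "\<Delta> \<noteq> 0" using \<Delta> \<alpha>12 by auto
  note \<Delta> = \<Delta> \<Delta>0
  obtain v \<pi> where v: "poly_valuation v" "\<pi> \<noteq> 0" "degree \<pi> \<le> 1" "\<bar>v \<pi>\<bar> = 1" "2 * v A1 < v A0"
    using ex_separating_valuation[OF nd] by blast
  obtain c where c: "\<And>n. E \<noteq> 0 \<Longrightarrow> u n \<noteq> 0 \<Longrightarrow> v (u n ^ 2 * \<Delta>) - v (E * (- A0) ^ n) \<le> int c - int n"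
    using poly_valuation.v_recurrence_bound[OF v(1) assms(1) nd(1,2) v(5) _ \<Delta>(2)]
    unfolding E_def by metis
  define \<kappa> where "\<kappa> = degree A0 + degree A1 + degree (u 0) + degree (u 1) + degree \<Delta>"
  define B :: nat where "B = 4 ^ (6 * 8 + 8 * 8)"
  define K where "K = \<kappa> * (c + 1 + 8 * (B * (16 * \<kappa> + 2)))"
  have main: "degree g \<le> K"
    if n12: "n1 \<le> n2" and gh: "u n1 + u n2 = pcompose g h" and ind: "indecomposable h"
      and y: "poly (map_poly af_const h - [:af_eval h af_x:]) y = 0"
      and cd: "conjugate_data A0 A1 u y \<beta>1 \<beta>2 \<delta>1 \<delta>2"
      and ns: "no_proper_vanishing_subsum
         [\<sigma>1 * \<alpha>1 ^ n1, \<sigma>2 * \<alpha>2 ^ n1, \<sigma>1 * \<alpha>1 ^ n2, \<sigma>2 * \<alpha>2 ^ n2,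
          - (\<delta>1 * \<beta>1 ^ n1), - (\<delta>2 * \<beta>2 ^ n1), - (\<delta>1 * \<beta>1 ^ n2), - (\<delta>2 * \<beta>2 ^ n2)]"
    for n1 n2 g h y \<beta>1 \<beta>2 \<delta>1 \<delta>2
  proof -
    have \<beta>: "\<beta>1 \<noteq> \<beta>2" "poly (char_poly_at A0 A1 y) \<beta>1 = 0" "poly (char_poly_at A0 A1 y) \<beta>2 = 0"
      and uy: "\<And>n. af_eval (u n) y = \<delta>1 * \<beta>1 ^ n + \<delta>2 * \<beta>2 ^ n"
      using cd by (auto simp: conjugate_data_def)
    note br = char_roots[OF \<beta>]
    have hy: "af_eval h y = fun_of h" using y by (simp add: af_eval_def[symmetric])
    have m2: "degree h \<ge> 2" using ind by (simp add: indecomposable_def)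
    interpret conjugate_point h \<Delta> y "\<alpha>1 - \<alpha>2" "\<beta>1 - \<beta>2"
      using m2 hy \<Delta> br(3) by unfold_locales (simp_all add: \<Delta>_def)
    have Vx: "V \<kappa> (fun_of A0)" "V \<kappa> (fun_of A1)" "V \<kappa> (fun_of (u 0))" "V \<kappa> (fun_of (u 1))"
      by (rule V_fun_of, simp add: \<kappa>_def)+
    have Vy: "V \<kappa> (af_eval A0 y)" "V \<kappa> (af_eval A1 y)" "V \<kappa> (af_eval (u 0) y)" "V \<kappa> (af_eval (u 1) y)"
      by (rule V_eval_y, simp add: \<kappa>_def)+
    have Vs: "V \<kappa> (\<alpha>1 - \<alpha>2)" "V \<kappa> (\<beta>1 - \<beta>2)"
      by (rule V.up[OF V.s], simp add: \<kappa>_def, rule V.up[OF V.r], simp add: \<kappa>_def)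
    have half: "a = (a + b + (a - b)) / 2" "b = (a + b - (a - b)) / 2" for a b :: algfun
      using halves_algfun(1) by (simp_all add: add_divide_distrib)
    have eVx: "fun_of A1 = \<alpha>1 + \<alpha>2" using al(1) by (simp add: \<alpha>1_def \<alpha>2_def)
    have "V \<kappa> ((\<alpha>1 + \<alpha>2 + (\<alpha>1 - \<alpha>2)) / 2)" "V \<kappa> ((\<alpha>1 + \<alpha>2 - (\<alpha>1 - \<alpha>2)) / 2)"
      unfolding eVx[symmetric]
      by (rule V_half[OF V_add[OF Vx(2) Vs(1) order.refl order.refl]])
         (rule V_half[OF V_diff[OF Vx(2) Vs(1) order.refl order.refl]])
    hence V\<alpha>: "V \<kappa> \<alpha>1" "V \<kappa> \<alpha>2" unfolding half[symmetric] .
    have eVy: "af_eval A1 y = \<beta>1 + \<beta>2" using br(1) by simp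
    have "V \<kappa> ((\<beta>1 + \<beta>2 + (\<beta>1 - \<beta>2)) / 2)" "V \<kappa> ((\<beta>1 + \<beta>2 - (\<beta>1 - \<beta>2)) / 2)"
      unfolding eVy[symmetric]
      by (rule V_half[OF V_add[OF Vy(2) Vs(2) order.refl order.refl]])
         (rule V_half[OF V_diff[OF Vy(2) Vs(2) order.refl order.refl]])
    hence V\<beta>: "V \<kappa> \<beta>1" "V \<kappa> \<beta>2" unfolding half[symmetric] .
    have \<sigma>Q: "\<sigma>1 \<in> Q (2 * \<kappa>)" "\<sigma>2 \<in> Q (2 * \<kappa>)"
      using coefficient_in_Q[OF Vx(4,3) V\<alpha>(2) Vs(1) \<alpha>12] coefficient_in_Q[OF Vx(4,3) V\<alpha>(1) Vs(1) \<alpha>12]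
      by (simp_all add: \<sigma>1_def \<sigma>2_def sigma1_def sigma2_def \<alpha>1_def \<alpha>2_def)
    have \<beta>12: "\<beta>1 - \<beta>2 \<noteq> 0" using \<beta>(1) by simp
    have "\<delta>1 * (\<beta>1 - \<beta>2) = af_eval (u 1) y - af_eval (u 0) y * \<beta>2"
      "\<delta>2 * (\<beta>1 - \<beta>2) = af_eval (u 0) y * \<beta>1 - af_eval (u 1) y"
      unfolding uy by (simp_all add: algebra_simps)
    hence "\<delta>1 = (af_eval (u 1) y - af_eval (u 0) y * \<beta>2) / (\<beta>1 - \<beta>2)"
      "\<delta>2 = (af_eval (u 0) y * \<beta>1 - af_eval (u 1) y) / (\<beta>1 - \<beta>2)"
      using \<beta>12 by (metis nonzero_mult_div_cancel_right)+
    hence \<delta>Q: "\<delta>1 \<in> Q (2 * \<kappa>)" "\<delta>2 \<in> Q (2 * \<kappa>)"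
      using coefficient_in_Q(1)[OF Vy(4,3) V\<beta>(2) Vs(2) \<beta>12] coefficient_in_Q(2)[OF Vy(4,3) V\<beta>(1) Vs(2) \<beta>12]
      by simp_all
    have "{\<alpha>1, \<alpha>2, \<beta>1, \<beta>2} \<subseteq> Q \<kappa>" using V\<alpha> V\<beta> Q_of_V by blast
    hence QQ: "{\<sigma>1, \<sigma>2, \<alpha>1, \<alpha>2, \<delta>1, \<delta>2, \<beta>1, \<beta>2} \<subseteq> Q (2 * \<kappa>)"
      using \<sigma>Q \<delta>Q Q_mono[of \<kappa> "2 * \<kappa>"] by auto
    have nz: "\<alpha>1 \<noteq> 0" "\<alpha>2 \<noteq> 0" "\<beta>1 \<noteq> 0" "\<beta>2 \<noteq> 0"
      using al(2) br(2) nd(1) y_transcendental[OF nd(1)] by (auto simp: \<alpha>1_def \<alpha>2_def)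
    have ux: "fun_of (u n) = \<sigma>1 * \<alpha>1 ^ n + \<sigma>2 * \<alpha>2 ^ n" for n
      using binet[OF assms(2,1)] by (simp add: \<alpha>1_def \<alpha>2_def \<sigma>1_def \<sigma>2_def)
    have "fun_of (u n1 + u n2) = af_eval (u n1 + u n2) y"
      unfolding gh af_eval_x[symmetric] af_eval_pcompose using hy by simp
    hence rel: "\<sigma>1 * \<alpha>1 ^ n1 + \<sigma>2 * \<alpha>2 ^ n1 + (\<sigma>1 * \<alpha>1 ^ n2 + \<sigma>2 * \<alpha>2 ^ n2)
        = \<delta>1 * \<beta>1 ^ n1 + \<delta>2 * \<beta>2 ^ n1 + (\<delta>1 * \<beta>1 ^ n2 + \<delta>2 * \<beta>2 ^ n2)"
      unfolding af_eval_simps fun_of_simps ux uy .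
    define L where "L = B * (6 * (2 * \<kappa>) + 2 * w)"
    define F G where "F = \<sigma>1 * \<alpha>1 ^ n2" and "G = \<sigma>2 * \<alpha>2 ^ n2"
    note ratio = ratio_of_terms_bound[OF ns rel QQ nz]
    have FG: "F / G \<in> Q L" "F \<noteq> 0" "G \<noteq> 0" "F + G \<noteq> 0"
      using ratio nz by (simp_all add: F_def G_def L_def B_def)
    have E0: "E \<noteq> 0"
      using sigma_product[OF assms(2), of u] ratio(2,3) \<Delta>(2)
      by (auto simp: E_def \<sigma>1_def \<sigma>2_def \<Delta>_def simp del: fun_of_simps(3,5,7))
    have uFG: "fun_of (u n2) = F + G" using ux[of n2] by (simp only: F_def G_def)
    hence un0: "u n2 \<noteq> 0" using FG(4) by auto
    have \<sigma>E: "\<sigma>1 * \<sigma>2 * fun_of \<Delta> = fun_of E"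
      using sigma_product[OF assms(2), of u] by (simp only: E_def \<sigma>1_def \<sigma>2_def \<Delta>_def)
    have \<alpha>A: "\<alpha>1 * \<alpha>2 = fun_of (- A0)" using al(2) by (simp add: \<alpha>1_def \<alpha>2_def)
    \<comment> \<open>Symmetrising the ratio in the two roots produces a rational function of \<open>x\<close>.\<close>
    have "F * G * fun_of \<Delta> = \<sigma>1 * \<sigma>2 * fun_of \<Delta> * (\<alpha>1 * \<alpha>2) ^ n2"
      unfolding F_def G_def power_mult_distrib by (simp only: mult_ac)
    also have "\<dots> = fun_of (E * (- A0) ^ n2)" by (simp only: \<sigma>E \<alpha>A fun_of_simps)
    finally have FGE: "fun_of (E * (- A0) ^ n2) = F * G * fun_of \<Delta>" by (rule sym)
    have "fun_of (u n2 ^ 2 * \<Delta>) = (F + G)\<^sup>2 * fun_of \<Delta>" by (simp only: fun_of_simps uFG)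
    hence "fun_of (u n2 ^ 2 * \<Delta>) / fun_of (E * (- A0) ^ n2) = (F + G)\<^sup>2 / (F * G)"
      unfolding FGE using \<Delta>(2) by simp
    also have "(F + G)\<^sup>2 = F * F + G * G + 2 * (F * G)"
      by (simp add: power2_eq_square algebra_simps)
    also have "\<dots> / (F * G) = F / G + inverse (F / G) + af_const 2"
      using FG(2,3) by (simp add: numeral_algfun(2)[symmetric] add_divide_distrib)
    also have "\<dots> \<in> Q (L + L + 0)"
      by (intro Q_add Q_inverse FG(1) Q_of_V V_const)
    finally have \<Theta>: "fun_of (u n2 ^ 2 * \<Delta>) / fun_of (E * (- A0) ^ n2) \<in> Q (L + L + 0)" .
    have "n2 - c \<le> 4 * (L + L + 0)"
    proof (rule valuation_bound[OF v(1-4) _ _ \<Theta>])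
      show "u n2 ^ 2 * \<Delta> \<noteq> 0" "E * (- A0) ^ n2 \<noteq> 0" using un0 \<Delta>(2) E0 nd(1) by simp_all
      show "int (n2 - c) \<le> \<bar>v (u n2 ^ 2 * \<Delta>) - v (E * (- A0) ^ n2)\<bar>"
        using c[OF E0 un0] by linarith
    qed
    hence n2: "n2 \<le> c + 8 * L" by (simp add: le_diff_conv)
    have "degree \<Delta> \<le> \<kappa>" by (simp add: \<kappa>_def)
    hence "6 * (2 * \<kappa>) + 2 * w \<le> 16 * \<kappa> * 1 + 2 * m" by simp
    also have "\<dots> \<le> 16 * \<kappa> * m + 2 * m" using m2 by (intro add_mono mult_le_mono2) simp_all
    finally have "L \<le> B * (16 * \<kappa> + 2) * m"
      unfolding L_def mult.assoc by (intro mult_le_mono2) (simp add: distrib_right)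
    hence "8 * L \<le> 8 * (B * (16 * \<kappa> + 2)) * m" by (simp only: mult.assoc mult_le_mono2)
    hence "n2 + 1 \<le> (c + 1) * 1 + 8 * (B * (16 * \<kappa> + 2)) * m" using n2 by simp
    also have "\<dots> \<le> (c + 1) * m + 8 * (B * (16 * \<kappa> + 2)) * m"
      using m2 by (intro add_mono mult_le_mono2) simp_all
    finally have n2m: "n2 + 1 \<le> (c + 1 + 8 * (B * (16 * \<kappa> + 2))) * m" by (simp only: distrib_right)
    have du: "degree (u n) \<le> \<kappa> * (n + 1)" for n
      by (rule degree_recurrence_le[OF assms(1)]) (simp_all add: \<kappa>_def)
    have "degree (u n1) \<le> \<kappa> * (n2 + 1)"
      using n12 by (intro order.trans[OF du] mult_le_mono2) simp
    hence "degree (u n1 + u n2) \<le> \<kappa> * (n2 + 1)" using du by (intro degree_add_le)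
    hence "degree g * m \<le> \<kappa> * (n2 + 1)" unfolding gh by (simp only: degree_pcompose)
    also have "\<dots> \<le> K * m"
      unfolding K_def mult.assoc[of \<kappa>] using n2m by (rule mult_le_mono2)
    finally show ?thesis using m2 by simp
  qed
  show ?thesis
  proof (intro exI[of _ "real K + 1"] conjI allI impI)
    fix n1 n2 g h y \<beta>1 \<beta>2 \<delta>1 \<delta>2
    assume "n1 \<le> n2" "u n1 + u n2 = pcompose g h" "indecomposable h"
      "poly (map_poly af_const h - [:af_eval h af_x:]) y = 0"
      "conjugate_data A0 A1 u y \<beta>1 \<beta>2 \<delta>1 \<delta>2"
      "no_proper_vanishing_subsum
         [sigma1 A0 A1 u * alpha1 A0 A1 ^ n1, sigma2 A0 A1 u * alpha2 A0 A1 ^ n1,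
          sigma1 A0 A1 u * alpha1 A0 A1 ^ n2, sigma2 A0 A1 u * alpha2 A0 A1 ^ n2,
          - (\<delta>1 * \<beta>1 ^ n1), - (\<delta>2 * \<beta>2 ^ n1),
          - (\<delta>1 * \<beta>1 ^ n2), - (\<delta>2 * \<beta>2 ^ n2)]"
    hence "degree g \<le> K" by (intro main) (simp_all only: \<alpha>1_def \<alpha>2_def \<sigma>1_def \<sigma>2_def)
    thus "real (degree g) \<le> real K + 1" by simp
  qed simp
qed

end
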